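(* Let $\mathcal T=(\emptyset=\mu_0,\mu_1,\dots,\mu_r)$ be an oscillating tableau, let $(\iota,T)$ be its image under Sundaram's first bijection with $\iota$ a fixed-point-free involution of $A$, let $I$ be the Robinson–Schensted row-insertion tableau of $\iota$, and let $Q$ be the standard tableau obtained by column-inserting the reverse reading word of $I$ into $T$. Let $A_{Rob},\iota_{Rob},T_{Rob},Q_{Rob},I_{Rob}$ be obtained from $\mathcal T$ by Roby's growth diagram construction (described in the context). Then $A_{Rob}=A$, $\iota_{Rob}=\iota$, $T_{Rob}=T$, $I_{Rob}=I$ and $Q_{Rob}=Q$.
   Context: An oscillating tableau of length $r$ is a sequence of partitions $(\emptyset=\mu_0,\dots,\mu_r)$ whose consecutive Ferrers diagrams differ by exactly one box; step $k$ is an expansion or contraction according as the box $b_k$ is added or removed. A partial Young tableau is a filling of a Ferrers shape by distinct positive integers increasing along rows and columns. Column insertion of $x$: insert into the first column; if $x$ exceeds all its entries place it at the bottom, else it replaces the smallest entry larger than $x$, which is inserted into the next column in the same way, etc. Column deletion of the entry $y$ of a corner box in column $j$: remove it, then for columns $j-1,\dots,1$ in turn replace the largest entry smaller than the current $y$ by $y$ and let $y$ be the replaced entry; the final $y$ is the output. Sundaram's first bijection: $\iota_0=T_0=\emptyset$; for $k=1,\dots,r$: on an expansion, $\iota_k=\iota_{k-1}$ and $T_k$ is $T_{k-1}$ with $k$ placed in $b_k$; on a contraction, column-delete the entry of $b_k$ from $T_{k-1}$ giving output $x$ and $T_k$, and $\iota_k=\iota_{k-1}$ with transposition $(x,k)$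 adjoined; $(\iota,T)=(\iota_r,T_r)$. $I$ is the row-insertion tableau of the word $\iota(a_1)\cdots\iota(a_m)$, $A=\{a_1<\dots<a_m\}$. The reverse reading word of $I$ reads the rows of $I$ top to bottom, each right to left. Local rules for a unit cell with corner labels $\lambda$ (lower left), $\mu$ (upper left), $\rho$ (upper right), $\nu$ (lower right); $\lambda\pm\epsilon_i$ denotes adding/removing a box in row $i$. Forward rules: (F1) if $\mu\ne\nu$, $\rho=\mu\cup\nu$; (F2) if $\lambda\ne\mu=\nu$ with $\mu=\lambda+\epsilon_i$, $\rho=\mu+\epsilon_{i+1}$; (F3) if $\lambda=\mu=\nu$, $\rho=\lambda$ if the cell is empty and $\rho=\lambda+\epsilon_1$ if it contains a cross. Backward rules: (B1) if $\mu\ne\nu$, $\lambda=\mu\cap\nu$ and the cell is empty; (B2) if $\rho\ne\mu=\nu$ with $\mu=\rho-\epsilon_i$: if $i=1$ then $\lambda=\mu$ and the cell gets a cross, if $i\ge2$ then $\lambda=\mu-\epsilon_{i-1}$ and the cell is empty; (B3) if $\rho=\mu=\nu$ then $\lambda=\mu$ and the cell is empty. Roby's construction: take lattice points $(x,y)$, $0\le x,y\le r$, and the $r^2$ unit cells; the cell with upper-right corner $(x,y)$ is said to lie in column $x$ and row $r+1-y$ (rows numbered from the top, as in a matrix). (R1) Label the point $(k,r-k)$ by the conjugate $\mu_k^t$, $k=0,\dots,r$. (R2) Determine the labels of all points with $x+y<r$ and the contents of all cells with upper-right corner satisfying $x+y\le r+1$ by the backward rules (cells straddling the diagonal fall under B1).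 (R3) Put a cross in the cell in row $i$, column $j$ above the diagonal whenever the cell in row $j$, column $i$ contains a cross. (R4) Determine the labels of all points with $x+y>r$ by the forward rules. Let $\tau_k$ and $\kappa_k$ be the labels of $(k,0)$ and $(k,r)$. Then $A_{Rob}$ is the set of column indices of cells containing crosses; $\iota_{Rob}(j)=i$ whenever the cell in column $j$, row $i$ contains a cross. A sequence $(\emptyset=\epsilon_0,\dots,\epsilon_r)$ of partitions with each $\epsilon_k$ equal to $\epsilon_{k-1}$ or obtained from it by adding one box determines the partial tableau having $k$ in the box added at step $k$ (and not containing $k$ if $\epsilon_k=\epsilon_{k-1}$). $T_{Rob}$ and $Q_{Rob}$ are the partial tableaux determined by $(\tau_k^t)_k$ and $(\kappa_k^t)_k$. For $I_{Rob}$: take a fresh $r\times r$ grid with crosses in the same cells, label all points on the lower border ($y=0$) and left border ($x=0$) by $\emptyset$, compute all other labels by the forward rules, let $\nu_k$ be the label of $(k,r)$, and let $I_{Rob}$ be the partial tableau determined by $(\nu_k^t)_k$. *)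

theory Defs
  imports Main
begin

(* Conventions: a cell is (row, column), both numbered from 1.
   A partition is identified with its Ferrers diagram, a finite set of cells.
   A partial tableau is a finite map from cells to positive integers. *)

type_synonym cell = "nat \<times> nat"
type_synonym tableau = "cell \<Rightarrow> nat option"

definition is_partition :: "cell set \<Rightarrow> bool" where
  "is_partition D \<longleftrightarrow> finite D \<and>
     (\<forall>(i,j)\<in>D. 1 \<le> i \<and> 1 \<le> j \<and>
        (\<forall>i' j'. 1 \<le> i' \<and> i' \<le> i \<and> 1 \<le> j' \<and> j' \<le> j \<longrightarrow> (i',j') \<in> D))"

definition conj :: "cell set \<Rightarrow> cell set" where
  "conj D = (\<lambda>(i,j). (j,i)) ` D"

definition rowlen :: "cell set \<Rightarrow> nat \<Rightarrow> nat" where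
  "rowlen D i = card {j. (i,j) \<in> D}"

definition add_box :: "cell set \<Rightarrow> nat \<Rightarrow> cell set" where
  "add_box D i = insert (i, Suc (rowlen D i)) D"

definition remove_box :: "cell set \<Rightarrow> nat \<Rightarrow> cell set" where
  "remove_box D i = D - {(i, rowlen D i)}"

definition box_row :: "cell set \<Rightarrow> cell set \<Rightarrow> nat" where
  "box_row big small = fst (the_elem (big - small))"

definition osc_tableau :: "cell set list \<Rightarrow> nat \<Rightarrow> bool" where
  "osc_tableau mus r \<longleftrightarrow> length mus = Suc r \<and> mus ! 0 = {} \<and>
     (\<forall>k\<le>r. is_partition (mus ! k)) \<and>
     (\<forall>k\<in>{1..r}. card ((mus ! k - mus ! (k-1)) \<union> (mus ! (k-1) - mus ! k)) = 1)"

fun col_del_aux :: "tableau \<Rightarrow> nat \<Rightarrow> nat \<Rightarrow> nat \<times> tableau" where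
  "col_del_aux T 0 y = (y, T)"
| "col_del_aux T (Suc c) y =
     (let v = Max {v. \<exists>i. T (i, Suc c) = Some v \<and> v < y};
          i = (THE i. T (i, Suc c) = Some v)
      in col_del_aux (T((i, Suc c) \<mapsto> y)) c v)"

definition col_delete :: "tableau \<Rightarrow> cell \<Rightarrow> nat \<times> tableau" where
  "col_delete T b = col_del_aux (T(b := None)) (snd b - 1) (the (T b))"

text \<open>column insertion into column c, with a fuel argument bounding the number of bumps\<close>
fun col_ins_aux :: "nat \<Rightarrow> tableau \<Rightarrow> nat \<Rightarrow> nat \<Rightarrow> tableau" where
  "col_ins_aux 0 T c x = T"
| "col_ins_aux (Suc n) T c x =
     (let vals = {v. \<exists>i. T (i, c) = Some v} in
      if \<forall>v\<in>vals. v < x then T((Suc (card vals), c) \<mapsto> x)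
      else (let v = Min {v\<in>vals. x < v};
                i = (THE i. T (i, c) = Some v)
            in col_ins_aux n (T((i, c) \<mapsto> x)) (Suc c) v))"

definition col_insert :: "tableau \<Rightarrow> nat \<Rightarrow> tableau" where
  "col_insert T x = col_ins_aux (Suc (card (dom T))) T 1 x"

fun row_ins_aux :: "nat \<Rightarrow> tableau \<Rightarrow> nat \<Rightarrow> nat \<Rightarrow> tableau" where
  "row_ins_aux 0 T i x = T"
| "row_ins_aux (Suc n) T i x =
     (let vals = {v. \<exists>j. T (i, j) = Some v} in
      if \<forall>v\<in>vals. v < x then T((i, Suc (card vals)) \<mapsto> x)
      else (let v = Min {v\<in>vals. x < v};
                j = (THE j. T (i, j) = Some v)
            in row_ins_aux n (T((i, j) \<mapsto> x)) (Suc i) v))"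

definition row_insert :: "tableau \<Rightarrow> nat \<Rightarrow> tableau" where
  "row_insert T x = row_ins_aux (Suc (card (dom T))) T 1 x"

text \<open>state: (iota, A, T); iota is a function that is the identity outside A\<close>
definition sund_step :: "cell set list \<Rightarrow> (nat \<Rightarrow> nat) \<times> nat set \<times> tableau \<Rightarrow> nat
    \<Rightarrow> (nat \<Rightarrow> nat) \<times> nat set \<times> tableau" where
  "sund_step mus st k = (case st of (iota, A, T) \<Rightarrow>
     if mus ! (k-1) \<subseteq> mus ! k
     then (iota, A, T(the_elem (mus ! k - mus ! (k-1)) \<mapsto> k))
     else (case col_delete T (the_elem (mus ! (k-1) - mus ! k)) of (x, T') \<Rightarrow>
             (iota(x := k, k := x), A \<union> {x, k}, T')))"

definition sundaram :: "cell set list \<Rightarrow> nat \<Rightarrow> (nat \<Rightarrow> nat) \<times> nat set \<times> tableau" where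
  "sundaram mus r = foldl (sund_step mus) (id, {}, Map.empty) [1..<Suc r]"

definition rs_insertion :: "(nat \<Rightarrow> nat) \<Rightarrow> nat set \<Rightarrow> tableau" where
  "rs_insertion iota A = foldl row_insert Map.empty (map iota (sorted_list_of_set A))"

definition tab_rowlen :: "tableau \<Rightarrow> nat \<Rightarrow> nat" where
  "tab_rowlen P i = card {j. (i,j) \<in> dom P}"

definition tab_nrows :: "tableau \<Rightarrow> nat" where
  "tab_nrows P = card {i. (i,1) \<in> dom P}"

definition rev_reading_word :: "tableau \<Rightarrow> nat list" where
  "rev_reading_word P = concat (map (\<lambda>i. rev (map (\<lambda>j. the (P (i,j))) [1..<Suc (tab_rowlen P i)]))
                                   [1..<Suc (tab_nrows P)])"

definition fwd_rule :: "cell set \<Rightarrow> cell set \<Rightarrow> cell set \<Rightarrow> bool \<Rightarrow> cell set" where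
  "fwd_rule lam mu nu c =
     (if mu \<noteq> nu then mu \<union> nu
      else if lam \<noteq> mu then add_box mu (Suc (box_row mu lam))
      else if c then add_box lam 1 else lam)"

definition back_rule :: "cell set \<Rightarrow> cell set \<Rightarrow> cell set \<Rightarrow> cell set \<times> bool" where
  "back_rule rho mu nu =
     (if mu \<noteq> nu then (mu \<inter> nu, False)
      else if rho \<noteq> mu then
        (let i = box_row rho mu in if i = 1 then (mu, True) else (remove_box mu (i - 1), False))
      else (mu, False))"

text \<open>labels of points (x,y) with x + y \<le> r (steps R1, R2)\<close>
function back_lab :: "cell set list \<Rightarrow> nat \<Rightarrow> nat \<Rightarrow> nat \<Rightarrow> cell set" where
  "back_lab mus r x y =
     (if r \<le> x + y then conj (mus ! x)
      else fst (back_rule (back_lab mus r (Suc x) (Suc y))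
                          (back_lab mus r x (Suc y))
                          (back_lab mus r (Suc x) y)))"
  by pat_completeness auto
termination by (relation "measure (\<lambda>(mus, r, x, y). r - (x + y))") auto

text \<open>content of the cell with upper-right corner (x,y), for x + y \<le> r + 1 (step R2)\<close>
definition back_cross :: "cell set list \<Rightarrow> nat \<Rightarrow> nat \<Rightarrow> nat \<Rightarrow> bool" where
  "back_cross mus r x y =
     snd (back_rule (back_lab mus r x y) (back_lab mus r (x - 1) y) (back_lab mus r x (y - 1)))"

text \<open>cross in the cell in column j, row i (rows numbered from the top); step R3\<close>
definition rob_cross :: "cell set list \<Rightarrow> nat \<Rightarrow> nat \<Rightarrow> nat \<Rightarrow> bool" where
  "rob_cross mus r j i \<longleftrightarrow> 1 \<le> i \<and> i \<le> r \<and> 1 \<le> j \<and> j \<le> r \<and>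
     (if j \<le> i then back_cross mus r j (Suc r - i) else back_cross mus r i (Suc r - j))"

function rob_lab :: "cell set list \<Rightarrow> nat \<Rightarrow> nat \<Rightarrow> nat \<Rightarrow> cell set" where
  "rob_lab mus r x y =
     (if x + y \<le> r then back_lab mus r x y
      else if x = 0 \<or> y = 0 then {}
      else fwd_rule (rob_lab mus r (x - 1) (y - 1)) (rob_lab mus r (x - 1) y)
                    (rob_lab mus r x (y - 1)) (rob_cross mus r x (Suc r - y)))"
  by pat_completeness auto
termination by (relation "measure (\<lambda>(mus, r, x, y). x + y)") auto

function rob_ilab :: "cell set list \<Rightarrow> nat \<Rightarrow> nat \<Rightarrow> nat \<Rightarrow> cell set" where
  "rob_ilab mus r x y =
     (if x = 0 \<or> y = 0 then {}
      else fwd_rule (rob_ilab mus r (x - 1) (y - 1)) (rob_ilab mus r (x - 1) y)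
                    (rob_ilab mus r x (y - 1)) (rob_cross mus r x (Suc r - y)))"
  by pat_completeness auto
termination by (relation "measure (\<lambda>(mus, r, x, y). x + y)") auto

fun tab_of_seq :: "(nat \<Rightarrow> cell set) \<Rightarrow> nat \<Rightarrow> tableau" where
  "tab_of_seq e 0 = Map.empty"
| "tab_of_seq e (Suc k) =
     (if e (Suc k) = e k then tab_of_seq e k
      else (tab_of_seq e k)(the_elem (e (Suc k) - e k) \<mapsto> Suc k))"

definition A_Rob :: "cell set list \<Rightarrow> nat \<Rightarrow> nat set" where
  "A_Rob mus r = {j. \<exists>i. rob_cross mus r j i}"

definition T_Rob :: "cell set list \<Rightarrow> nat \<Rightarrow> tableau" where
  "T_Rob mus r = tab_of_seq (\<lambda>k. conj (rob_lab mus r k 0)) r"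

definition Q_Rob :: "cell set list \<Rightarrow> nat \<Rightarrow> tableau" where
  "Q_Rob mus r = tab_of_seq (\<lambda>k. conj (rob_lab mus r k r)) r"

definition I_Rob :: "cell set list \<Rightarrow> nat \<Rightarrow> tableau" where
  "I_Rob mus r = tab_of_seq (\<lambda>k. conj (rob_ilab mus r k r)) r"

end

theory Submission
  imports Defs
begin

text \<open>
  A partial tableau is a chain of shapes, and inserting \<open>x\<close> into it changes the chain by the forward
  rules: the part below \<open>x\<close> is unchanged, \<open>x\<close> itself creates a box in the first row, and each later
  entry either leaves the new box alone (F1) or is bumped out of it into the next row (F2).
  The rows of Roby's diagram, read with conjugate labels, are therefore tableaux, each obtained from
  the one below by column-inserting the column index of the cross between them. Read downwards
  along the diagonal this is Sundaram's column deletion, which identifies the crosses with \<open>\<iota>\<close> and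
  the bottom row with \<open>T\<close>. Read upwards over the full square, the word \<open>\<iota>(a\<^sub>m) \<dots> \<iota>(a\<^sub>1)\<close> is
  column-inserted into \<open>T\<close>, or into the empty tableau in the case of \<open>I\<close>.

  The comparison with the row insertion tableau and with its reading word rests on Schensted's
  theorem that row and column insertion commute, which for chains of shapes is a check of the local
  rules. Since \<open>T\<close> is itself a row insertion tableau, column insertion of a word \<open>u\<close> into \<open>T\<close>
  depends only on the column insertion tableau of \<open>u\<close>.
\<close>

section \<open>Partitions and local rules\<close>

text \<open>The local rules see only shapes; the algorithms see only entries, selected by
  \<open>Min\<close>, \<open>Max\<close> and \<open>THE\<close>. They meet in one observation:
  erasing the largest entry of a tableau shortens its chain by one step, and a new largest entry
  \<open>N\<close> disturbs an insertion only if the insertion ends in the box of \<open>N\<close>.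
  Every link between an algorithm and the rules is therefore an induction on the bound of the
  entries, resting on one extension lemma about a new largest entry
  (\<open>row_ins_aux_extend\<close>, \<open>cdel_extend\<close>). A bumping path is followed as a
  whole only for the reading word, where it is a row sliding to the right. Numbers that are not
  entries are stalls of the chain. A cross can stand only at a stall, which is why freshness of the
  inserted number is tracked throughout. F2 and F3 speak of rows and so describe row insertion.
  Since Roby's labels are conjugates, his diagram is read as row insertion and transposed at the
  end, which gives the column operations.\<close>

definition addable :: "cell set \<Rightarrow> cell \<Rightarrow> bool" where
  "addable D c \<longleftrightarrow> is_partition D \<and> is_partition (insert c D) \<and> c \<notin> D"

definition grow :: "cell set \<Rightarrow> cell set \<Rightarrow> bool" where
  "grow D E \<longleftrightarrow> is_partition D \<and> is_partition E \<and> (E = D \<or> (\<exists>c. c \<notin> D \<and> E = insert c D))"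

lemma partition_down:
  assumes "is_partition D" "(i, j) \<in> D" "1 \<le> i'" "i' \<le> i" "1 \<le> j'" "j' \<le> j"
  shows "(i', j') \<in> D"
  using assms unfolding is_partition_def by fast

lemma partition_pos:
  assumes "is_partition D" "(i, j) \<in> D"
  shows "1 \<le> i" "1 \<le> j"
  using assms unfolding is_partition_def by fast+

lemma partition_finite: "is_partition D \<Longrightarrow> finite D"
  unfolding is_partition_def by blast

lemma is_partition_empty [simp]: "is_partition {}"
  unfolding is_partition_def by simp

lemma initial_segment_nat:
  fixes S :: "nat set"
  assumes "finite S" "\<And>j. j \<in> S \<Longrightarrow> 1 \<le> j" "\<And>j j'. j \<in> S \<Longrightarrow> 1 \<le> j' \<Longrightarrow> j' \<le> j \<Longrightarrow> j' \<in> S"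
  shows "S = {1..card S}"
proof (cases "S = {}")
  case False
  have "S = {1..Max S}"
  proof
    show "S \<subseteq> {1..Max S}" using assms(1,2) by auto
    show "{1..Max S} \<subseteq> S" using assms(3)[OF Max_in[OF assms(1) False]] by auto
  qed
  moreover from this have "card S = Max S"
    by (metis card_atLeastAtMost diff_Suc_1)
  ultimately show ?thesis by simp
qed simp

lemma partition_row:
  assumes "is_partition D"
  shows "{j. (i, j) \<in> D} = {1..rowlen D i}"
  unfolding rowlen_def
proof (rule initial_segment_nat)
  have "{j. (i, j) \<in> D} \<subseteq> snd ` D" by force
  then show "finite {j. (i, j) \<in> D}"
    using finite_subset partition_finite[OF assms] by blast
next
  show "1 \<le> j" if "j \<in> {j. (i, j) \<in> D}" for j
    using that partition_pos[OF assms] by blast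
  show "j' \<in> {j. (i, j) \<in> D}" if "j \<in> {j. (i, j) \<in> D}" "1 \<le> j'" "j' \<le> j" for j j'
    using that partition_down[OF assms, of i j i j'] partition_pos[OF assms, of i j] by simp
qed

lemma partition_mem_iff:
  assumes "is_partition D"
  shows "(i, j) \<in> D \<longleftrightarrow> 1 \<le> j \<and> j \<le> rowlen D i"
proof -
  have "j \<in> {j. (i, j) \<in> D} \<longleftrightarrow> j \<in> {1..rowlen D i}"
    by (simp only: partition_row[OF assms])
  then show ?thesis by simp
qed

lemma addable_iff:
  assumes D: "is_partition D"
  shows "addable D (i, j) \<longleftrightarrow> (i, j) \<notin> D \<and> 1 \<le> i \<and> 1 \<le> j
    \<and> (i = 1 \<or> (i - 1, j) \<in> D) \<and> (j = 1 \<or> (i, j - 1) \<in> D)" (is "?l \<longleftrightarrow> ?r")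
proof
  assume l: ?l
  then have E: "is_partition (insert (i, j) D)" by (simp add: addable_def)
  show ?r
    using l partition_pos[OF E, of i j] partition_down[OF E, of i j "i - 1" j]
      partition_down[OF E, of i j i "j - 1"]
    by (auto simp: addable_def) linarith+
next
  assume r: ?r
  have "(a, b) \<in> insert (i, j) D" if "1 \<le> a" "a \<le> i" "1 \<le> b" "b \<le> j" for a b
  proof (cases "a = i")
    case True
    then show ?thesis
      using r that partition_down[OF D, of i "j - 1" i b] by (cases "b = j") auto
  next
    case False
    then show ?thesis
      using r that partition_down[OF D, of "i - 1" j a b] by auto
  qed
  then have "is_partition (insert (i, j) D)"
    using r D unfolding is_partition_def by auto
  then show ?l using D r by (simp add: addable_def)
qed

lemma addable_rowlen:
  assumes "addable D c"
  shows "snd c = Suc (rowlen D (fst c))"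
proof -
  obtain i j where c: "c = (i, j)" by force
  have D: "is_partition D" using assms by (simp add: addable_def)
  have "1 \<le> j" "\<not> j \<le> rowlen D i" "j = 1 \<or> j - 1 \<le> rowlen D i"
    using assms unfolding c addable_iff[OF D] partition_mem_iff[OF D] by auto
  then show ?thesis unfolding c by (simp; linarith)
qed

lemma addable_same_row:
  assumes "addable D c" "addable D d" "fst c = fst d"
  shows "c = d"
  using addable_rowlen[OF assms(1)] addable_rowlen[OF assms(2)] assms(3)
  by (simp add: prod_eq_iff)

section \<open>Conjugate shapes\<close>

lemma conj_mem [simp]: "(i, j) \<in> conj D \<longleftrightarrow> (j, i) \<in> D"
  unfolding conj_def by force

lemma conj_conj [simp]: "conj (conj D) = D"
  by auto

lemma conj_eq_iff [simp]: "conj D = conj E \<longleftrightarrow> D = E"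
  by (metis conj_conj)

lemma conj_empty [simp]: "conj {} = {}"
  unfolding conj_def by simp

lemma conj_insert [simp]: "conj (insert (i, j) D) = insert (j, i) (conj D)"
  unfolding conj_def by auto

lemma conj_Int: "conj (D \<inter> E) = conj D \<inter> conj E"
  by auto

lemma inj_flip: "inj_on (\<lambda>(i :: nat, j :: nat). (j, i)) S"
  by (auto simp: inj_on_def)

lemma card_conj [simp]: "card (conj D) = card D"
  unfolding conj_def by (rule card_image[OF inj_flip])

lemma partition_conj [simp]: "is_partition (conj D) \<longleftrightarrow> is_partition D"
proof -
  have *: "is_partition (conj E)" if E: "is_partition E" for E
  proof -
    have "finite (conj E)" using partition_finite[OF E] by (simp add: conj_def)
    moreover have "1 \<le> i \<and> 1 \<le> j \<and> (\<forall>i' j'. 1 \<le> i' \<and> i' \<le> i \<and> 1 \<le> j' \<and> j' \<le> j \<longrightarrow> (i', j') \<in> conj E)"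
      if "(i, j) \<in> conj E" for i j
      using that partition_down[OF E, of j i] partition_pos[OF E, of j i] unfolding conj_mem by blast
    ultimately show ?thesis unfolding is_partition_def by blast
  qed
  show ?thesis using *[of D] *[of "conj D"] by auto
qed

lemma addable_conj [simp]: "addable (conj D) (i, j) \<longleftrightarrow> addable D (j, i)"
  unfolding addable_def by (metis conj_insert conj_mem partition_conj)

lemma grow_conj [simp]: "grow (conj D) (conj E) \<longleftrightarrow> grow D E"
proof -
  have *: "grow (conj D) (conj E)" if "grow D E" for D E
    using that unfolding grow_def by (auto; metis conj_insert conj_mem surj_pair)
  show ?thesis using *[of D E] *[of "conj D" "conj E"] by auto
qed

lemma grow_refl: "is_partition D \<Longrightarrow> grow D D"
  by (simp add: grow_def)

lemma grow_cases:
  assumes "grow D E"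
  obtains "E = D" "is_partition D" | c where "addable D c" "E = insert c D"
  using assms unfolding grow_def addable_def by blast

lemma growI_addable: "addable D c \<Longrightarrow> grow D (insert c D)"
  unfolding grow_def addable_def by blast

lemma addable_insert_other:
  assumes "addable D c" "addable D d" "c \<noteq> d"
  shows "addable (insert c D) d"
proof -
  have D: "is_partition D" and E: "is_partition (insert c D)"
    using assms by (auto simp: addable_def)
  obtain i j where d: "d = (i, j)" by force
  show ?thesis using assms(2,3) unfolding d addable_iff[OF D] addable_iff[OF E] by auto
qed

lemma box_row_insert: "c \<notin> D \<Longrightarrow> box_row (insert c D) D = fst c"
  unfolding box_row_def by (simp add: insert_Diff_if)

lemma add_box_addable:
  assumes "addable D c"
  shows "add_box D (fst c) = insert c D"
  using addable_rowlen[OF assms] unfolding add_box_def by (metis prod.collapse)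

lemma addable_first_row:
  assumes D: "is_partition D"
  shows "addable D (1, Suc (rowlen D 1))"
  unfolding addable_iff[OF D] by (auto simp: partition_mem_iff[OF D])

text \<open>Row lengths decrease weakly, so lengthening row \<open>fst b\<close> leaves room at the
  end of the row below it. This makes F2 produce a partition.\<close>

lemma addable_next_row:
  assumes b: "addable D b"
  shows "addable (insert b D) (Suc (fst b), Suc (rowlen D (Suc (fst b))))" (is "addable ?E (?i', ?j')")
proof -
  have D: "is_partition D" and E: "is_partition ?E" using b by (auto simp: addable_def)
  obtain i j where bij: "b = (i, j)" by force
  have j: "j = Suc (rowlen D i)" using addable_rowlen[OF b] bij by simp
  have ij: "(i, j) \<notin> D" "1 \<le> i" "1 \<le> j"
    using b unfolding bij addable_iff[OF D] by auto
  have "rowlen D (Suc i) \<le> rowlen D i"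
  proof (rule ccontr)
    assume "\<not> ?thesis"
    then have "(Suc i, j) \<in> D" using j partition_mem_iff[OF D] by simp
    then show False using partition_down[OF D] ij by fastforce
  qed
  then show ?thesis
    unfolding addable_iff[OF E] using ij j
    by (auto simp: bij partition_mem_iff[OF D])
qed

section \<open>Values of the forward rules\<close>

lemma fwd_rule_same: "grow D E \<Longrightarrow> fwd_rule D E D False = E"
  unfolding fwd_rule_def grow_def by auto

lemma fwd_rule_stay: "grow D E \<Longrightarrow> fwd_rule D D E False = E"
  unfolding fwd_rule_def grow_def by auto

lemma fwd_rule_diff:
  assumes "b \<notin> D" "c \<notin> D" "b \<noteq> c"
  shows "fwd_rule D (insert b D) (insert c D) False = insert b (insert c D)"
  using assms unfolding fwd_rule_def by auto

lemma rowlen_insert_other: "fst b \<noteq> i \<Longrightarrow> rowlen (insert b D) i = rowlen D i"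
  unfolding rowlen_def by (metis (no_types, lifting) fst_conv insert_iff)

lemma fwd_rule_bump:
  assumes b: "addable D b"
  shows "fwd_rule D (insert b D) (insert b D) False
    = insert (Suc (fst b), Suc (rowlen D (Suc (fst b)))) (insert b D)"
proof -
  have "b \<notin> D" using b by (simp add: addable_def)
  then have ne: "D \<noteq> insert b D" by auto
  show ?thesis
    unfolding fwd_rule_def using ne
    by (simp add: box_row_insert[OF \<open>b \<notin> D\<close>] add_box_def rowlen_insert_other)
qed

lemma fwd_rule_cross: "fwd_rule D D D True = insert (1, Suc (rowlen D 1)) D"
  unfolding fwd_rule_def add_box_def by simp

text \<open>The bumped box is recognised by its row alone, since a row has only one addable box.
  Case analyses may thus name it by any witness that suits them.\<close>

lemma fwd_rule_bump_eq:
  assumes "addable D b" "addable (insert b D) c" "fst c = Suc (fst b)"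
  shows "fwd_rule D (insert b D) (insert b D) False = insert c (insert b D)"
  using addable_same_row[OF assms(2) addable_next_row[OF assms(1)]] assms(3)
  by (simp add: fwd_rule_bump[OF assms(1)])

text \<open>Opposite sides of a cell are trivial together, unless there is a cross: then left and
  bottom are trivial, top and right are not. The two equivalences carry this along a whole strip of
  cells.\<close>

lemma fwd_rule_grow:
  assumes lm: "grow D E" and ln: "grow D F" and c: "c \<Longrightarrow> E = D \<and> F = D"
  shows "grow E (fwd_rule D E F c)" "grow F (fwd_rule D E F c)"
    "fwd_rule D E F c = F \<longleftrightarrow> E = D \<and> \<not> c" "fwd_rule D E F c = E \<longleftrightarrow> F = D \<and> \<not> c"
proof -
  have D: "is_partition D" using lm by (simp add: grow_def)
  have "grow E (fwd_rule D E F c) \<and> grow F (fwd_rule D E F c)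
    \<and> (fwd_rule D E F c = F \<longleftrightarrow> E = D \<and> \<not> c) \<and> (fwd_rule D E F c = E \<longleftrightarrow> F = D \<and> \<not> c)"
  proof (cases c)
    case True
    then show ?thesis
      using c[OF True] addable_first_row[OF D] growI_addable[OF addable_first_row[OF D]]
      by (auto simp: fwd_rule_cross addable_def)
  next
    case False
    show ?thesis using lm
    proof (cases rule: grow_cases)
      case 1
      then show ?thesis using fwd_rule_stay[OF ln] ln False by (auto simp: grow_def)
    next
      case (2 a)
      have aD: "a \<notin> D" using 2 by (simp add: addable_def)
      show ?thesis using ln
      proof (cases rule: grow_cases)
        case 1
        then show ?thesis using fwd_rule_same[OF lm] lm False by (auto simp: grow_def)
      next
        case (2 b)
        have bD: "b \<notin> D" using 2 by (simp add: addable_def)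
        show ?thesis
        proof (cases "a = b")
          case True
          then show ?thesis
            using \<open>E = insert a D\<close> 2 False aD growI_addable[OF addable_next_row[OF 2(1)]]
              addable_next_row[OF 2(1)] unfolding addable_def
            by (auto simp: fwd_rule_bump[OF 2(1)])
        next
          case ne: False
          have "fwd_rule D E F c = insert a (insert b D)"
            using fwd_rule_diff[OF aD bD ne] 2 \<open>E = insert a D\<close> False by simp
          moreover have "grow (insert b D) (insert a (insert b D))"
            using growI_addable addable_insert_other 2 \<open>addable D a\<close> ne by metis
          moreover have "grow (insert a D) (insert a (insert b D))"
            using growI_addable addable_insert_other 2 \<open>addable D a\<close> ne by (metis insert_commute)
          ultimately show ?thesis using 2 \<open>E = insert a D\<close> aD bD ne by auto
        qed
      qed
    qed
  qed
  then show "grow E (fwd_rule D E F c)" "grow F (fwd_rule D E F c)"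
    "fwd_rule D E F c = F \<longleftrightarrow> E = D \<and> \<not> c" "fwd_rule D E F c = E \<longleftrightarrow> F = D \<and> \<not> c" by auto
qed

section \<open>Growth sequences and their tableaux\<close>

text \<open>Stalls \<open>e k = e (Suc k)\<close> are allowed: they encode the numbers missing from
  a partial tableau.\<close>

definition growth :: "(nat \<Rightarrow> cell set) \<Rightarrow> nat \<Rightarrow> bool" where
  "growth e n \<longleftrightarrow> e 0 = {} \<and> (\<forall>k<n. grow (e k) (e (Suc k)))"

lemma growth_SucD: "growth e (Suc n) \<Longrightarrow> growth e n"
  by (simp add: growth_def)

lemma growth_le: "growth e n \<Longrightarrow> m \<le> n \<Longrightarrow> growth e m"
  by (simp add: growth_def)

lemma growth_step: "growth e n \<Longrightarrow> k < n \<Longrightarrow> grow (e k) (e (Suc k))"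
  by (simp add: growth_def)

lemma growth_partition: "growth e n \<Longrightarrow> k \<le> n \<Longrightarrow> is_partition (e k)"
  by (cases k) (auto simp: growth_def grow_def)

lemma growth_mono:
  assumes "growth e n" "i \<le> j" "j \<le> n"
  shows "e i \<subseteq> e j"
  using assms(2,3)
proof (induction j rule: dec_induct)
  case (step k)
  have "e k \<subseteq> e (Suc k)" using growth_step[OF assms(1), of k] step by (auto simp: grow_def)
  then show ?case using step by auto
qed simp

lemma growth_conj [simp]: "growth (\<lambda>k. conj (e k)) n \<longleftrightarrow> growth e n"
  unfolding growth_def using conj_eq_iff[of "e 0" "{}"] by simp

lemma tab_of_seq_cong:
  "(\<And>k. k \<le> n \<Longrightarrow> e k = f k) \<Longrightarrow> tab_of_seq e n = tab_of_seq f n"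
  by (induction n) auto

lemma tab_of_seq_add:
  assumes "e (Suc n) = insert b (e n)" "b \<notin> e n"
  shows "tab_of_seq e (Suc n) = (tab_of_seq e n)(b \<mapsto> Suc n)"
proof -
  have "e (Suc n) - e n = {b}" "e (Suc n) \<noteq> e n" using assms by auto
  then show ?thesis by simp
qed

lemma tab_of_seq_iff:
  "growth e n \<Longrightarrow> tab_of_seq e n c = Some v \<longleftrightarrow> 1 \<le> v \<and> v \<le> n \<and> c \<in> e v \<and> c \<notin> e (v - 1)"
proof (induction n)
  case (Suc n)
  note IH = Suc.IH[OF growth_SucD[OF Suc.prems]]
  have mono: "v \<le> n \<Longrightarrow> e v \<subseteq> e n" for v
    using growth_mono[OF Suc.prems, of v n] by simp
  show ?case
    using growth_step[OF Suc.prems, of n, simplified]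
  proof (cases rule: grow_cases)
    case 1
    then show ?thesis using IH by (auto simp: le_Suc_eq)
  next
    case (2 b)
    then have b: "b \<notin> e n" by (simp add: addable_def)
    show ?thesis
      unfolding tab_of_seq_add[OF 2(2) b]
      using IH mono[of v] b 2(2) by (auto simp: le_Suc_eq)
  qed
qed (auto simp: growth_def)

lemma dom_tab_of_seq: "growth e n \<Longrightarrow> dom (tab_of_seq e n) = e n"
proof (induction n)
  case (Suc n)
  note IH = Suc.IH[OF growth_SucD[OF Suc.prems]]
  show ?case
    using growth_step[OF Suc.prems, of n, simplified]
  proof (cases rule: grow_cases)
    case 1
    then show ?thesis using IH by simp
  next
    case (2 b)
    then have b: "b \<notin> e n" by (simp add: addable_def)
    show ?thesis
      unfolding tab_of_seq_add[OF 2(2) b] dom_fun_upd using IH 2 by simp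
  qed
qed (simp add: growth_def)

lemma ran_tab_of_seq:
  assumes "growth e n"
  shows "v \<in> ran (tab_of_seq e n) \<longleftrightarrow> 1 \<le> v \<and> v \<le> n \<and> e v \<noteq> e (v - 1)"
  using growth_mono[OF assms, of "v - 1" v] by (auto simp: ran_def tab_of_seq_iff[OF assms])

definition inj_tab :: "tableau \<Rightarrow> bool" where
  "inj_tab T \<longleftrightarrow> (\<forall>c d v. T c = Some v \<longrightarrow> T d = Some v \<longrightarrow> c = d)"

lemma inj_tabD: "inj_tab T \<Longrightarrow> T c = Some v \<Longrightarrow> T d = Some v \<Longrightarrow> c = d"
  unfolding inj_tab_def by blast

lemma inj_tab_of_seq:
  assumes "growth e n"
  shows "inj_tab (tab_of_seq e n)"
  unfolding inj_tab_def
proof (intro allI impI)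
  fix c d v
  assume cd: "tab_of_seq e n c = Some v" "tab_of_seq e n d = Some v"
  then have "grow (e (v - 1)) (e v)"
    using growth_step[OF assms, of "v - 1"] by (auto simp: tab_of_seq_iff[OF assms])
  then show "c = d" using cd by (auto simp: tab_of_seq_iff[OF assms] grow_def)
qed

text \<open>If \<open>v'\<close> came before \<open>v\<close>, the shape \<open>e v'\<close> would
  contain \<open>(i', j')\<close> and by downward closure also \<open>(i, j)\<close>, which enters
  only at step \<open>v\<close>.\<close>

lemma tab_of_seq_less:
  assumes g: "growth e n"
    and v: "tab_of_seq e n (i, j) = Some v" and v': "tab_of_seq e n (i', j') = Some v'"
    and le: "i \<le> i'" "j \<le> j'" "(i, j) \<noteq> (i', j')"
  shows "v < v'"
proof -
  have "v \<noteq> v'" using inj_tabD[OF inj_tab_of_seq[OF g] v] v' le(3) by blast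
  moreover have "v \<le> v'"
  proof (rule ccontr)
    assume "\<not> v \<le> v'"
    then have lt: "v' \<le> v - 1" by simp
    have a: "1 \<le> v" "v \<le> n" "(i, j) \<in> e v" "(i, j) \<notin> e (v - 1)"
      using v by (auto simp: tab_of_seq_iff[OF g])
    have b: "v' \<le> n" "(i', j') \<in> e v'" using v' by (auto simp: tab_of_seq_iff[OF g])
    have "1 \<le> i" "1 \<le> j" using partition_pos[OF growth_partition[OF g a(2)] a(3)] by auto
    then have "(i, j) \<in> e v'" using partition_down[OF growth_partition[OF g b(1)] b(2)] le by blast
    then show False using growth_mono[OF g lt] a(2,4) by (meson diff_le_self order_trans subsetD)
  qed
  ultimately show ?thesis by simp
qed

text \<open>The upper border of a strip of unit cells whose lower border is \<open>e\<close>, whose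
  left side is empty and whose only cross is in column \<open>x\<close>.\<close>

primrec rins :: "(nat \<Rightarrow> cell set) \<Rightarrow> nat \<Rightarrow> nat \<Rightarrow> cell set" where
  "rins e x 0 = {}"
| "rins e x (Suc k) = fwd_rule (e k) (rins e x k) (e (Suc k)) (Suc k = x)"

text \<open>Absence of \<open>x\<close> from the tableau, phrased as a stall of the chain: this is
  the form in which F3 asks for it.\<close>

definition fresh :: "(nat \<Rightarrow> cell set) \<Rightarrow> nat \<Rightarrow> nat \<Rightarrow> bool" where
  "fresh e n x \<longleftrightarrow> 1 \<le> x \<and> x \<le> n \<and> e x = e (x - 1)"

lemma fresh_iff: "growth e n \<Longrightarrow> fresh e n x \<longleftrightarrow> 1 \<le> x \<and> x \<le> n \<and> x \<notin> ran (tab_of_seq e n)"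
  by (auto simp: fresh_def ran_tab_of_seq)

text \<open>Up to \<open>x\<close> nothing happens; from \<open>x\<close> on the upper border is
  exactly one box ahead of the lower one. Once created, the extra box cannot vanish, because
  opposite sides of a cell without a cross are trivial together.\<close>

lemma rins_step:
  assumes g: "growth e n" and x: "fresh e n x"
  shows "k \<le> n \<Longrightarrow> grow (e k) (rins e x k) \<and> (rins e x k = e k \<longleftrightarrow> k < x)
     \<and> (0 < k \<longrightarrow> grow (rins e x (k - 1)) (rins e x k))"
proof (induction k)
  case 0
  then show ?case using g x by (simp add: growth_def fresh_def grow_def)
next
  case (Suc k)
  have *: "Suc k = x \<Longrightarrow> rins e x k = e k \<and> e (Suc k) = e k"
    using Suc x by (auto simp: fresh_def)
  have IH: "grow (e k) (rins e x k)" "rins e x k = e k \<longleftrightarrow> k < x" using Suc by auto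
  show ?case
    using fwd_rule_grow[OF IH(1) growth_step[OF g, of k], of "Suc k = x"] * Suc.prems IH(2)
    by auto
qed

lemma growth_rins:
  assumes "growth e n" "fresh e n x"
  shows "growth (rins e x) n"
  unfolding growth_def using rins_step[OF assms, of "Suc _"] by simp

lemma rins_before: "growth e n \<Longrightarrow> fresh e n x \<Longrightarrow> k < x \<Longrightarrow> rins e x k = e k"
  using rins_step[of e n x k] by (auto simp: fresh_def)

lemma rins_after:
  assumes "growth e n" "fresh e n x" "x \<le> k" "k \<le> n"
  obtains b where "addable (e k) b" "rins e x k = insert b (e k)"
  using rins_step[OF assms(1,2,4)] assms(3) by (metis grow_cases linorder_not_less)

section \<open>Insertion as growth\<close>

text \<open>While an entry is in transit the filling need not increase along columns, and the
  recursion may start in any row. Rows that are initial segments, together with distinct entries,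
  are all that an induction over bumps can keep, and they suffice to locate the ends of
  rows.\<close>

definition left_justified :: "tableau \<Rightarrow> bool" where
  "left_justified T \<longleftrightarrow> finite (dom T) \<and> (\<forall>i. {j. (i, j) \<in> dom T} = {1..rowlen (dom T) i})"

lemma left_justified_mem:
  "left_justified T \<Longrightarrow> (i, j) \<in> dom T \<longleftrightarrow> 1 \<le> j \<and> j \<le> rowlen (dom T) i"
  unfolding left_justified_def by (metis (no_types, lifting) atLeastAtMost_iff mem_Collect_eq)

lemma left_justified_tab_of_seq:
  assumes "growth e n"
  shows "left_justified (tab_of_seq e n)"
  using growth_partition[OF assms, of n] partition_row partition_finite
  by (simp add: left_justified_def dom_tab_of_seq[OF assms])

definition row_vals :: "tableau \<Rightarrow> nat \<Rightarrow> nat set" where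
  "row_vals T i = {v. \<exists>j. T (i, j) = Some v}"

lemma row_vals_upd:
  assumes "T (i, j) = None"
  shows "row_vals (T((i, j) \<mapsto> v)) i' = (if i' = i then insert v (row_vals T i) else row_vals T i')"
  using assms unfolding row_vals_def by (auto; metis option.distinct(1))

lemma row_vals_image: "row_vals T i = (\<lambda>j. the (T (i, j))) ` {j. (i, j) \<in> dom T}"
  unfolding row_vals_def by force

lemma card_row_vals:
  assumes "inj_tab T" "left_justified T"
  shows "card (row_vals T i) = rowlen (dom T) i"
proof -
  have "inj_on (\<lambda>j. the (T (i, j))) {j. (i, j) \<in> dom T}"
    by (rule inj_onI) (use inj_tabD[OF assms(1)] in fastforce)
  then show ?thesis unfolding row_vals_image rowlen_def by (rule card_image)
qed

lemma finite_row_vals: "left_justified T \<Longrightarrow> finite (row_vals T i)"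
  unfolding row_vals_image left_justified_def by (metis finite_atLeastAtMost finite_imageI)

lemma row_ins_aux_Suc:
  "row_ins_aux (Suc n) T i x =
     (if \<forall>v\<in>row_vals T i. v < x then T((i, Suc (card (row_vals T i))) \<mapsto> x)
      else row_ins_aux n (T((i, THE j. T (i, j) = Some (Min {v \<in> row_vals T i. x < v})) \<mapsto> x))
        (Suc i) (Min {v \<in> row_vals T i. x < v}))"
  unfolding row_ins_aux.simps Let_def row_vals_def ..

lemma row_ins_aux_end:
  assumes "0 < n" "inj_tab T" "left_justified T" "\<forall>v\<in>row_vals T i. v < x"
  shows "row_ins_aux n T i x = T((i, Suc (rowlen (dom T) i)) \<mapsto> x)"
  using assms card_row_vals[OF assms(2,3)] by (cases n) (auto simp: row_ins_aux_Suc simp del: row_ins_aux.simps)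

lemma row_ins_aux_bump:
  assumes "inj_tab T" "T (i, j) = Some v" "x < v" "\<And>w. w \<in> row_vals T i \<Longrightarrow> x < w \<Longrightarrow> v \<le> w"
    "finite (row_vals T i)"
  shows "row_ins_aux (Suc n) T i x = row_ins_aux n (T((i, j) \<mapsto> x)) (Suc i) v"
proof -
  have v: "v \<in> row_vals T i" using assms(2) by (auto simp: row_vals_def)
  then have m: "Min {v \<in> row_vals T i. x < v} = v"
    using assms(3,4,5) by (intro Min_eqI) auto
  have "(THE j. T (i, j) = Some v) = j"
    using inj_tabD[OF assms(1) assms(2)] assms(2) by blast
  then show ?thesis using v assms(3) by (auto simp: row_ins_aux_Suc m simp del: row_ins_aux.simps)
qed

lemma dom_upd_mem: "c \<in> dom T \<Longrightarrow> dom (T(c \<mapsto> x)) = dom T"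
  by auto

lemma inj_tab_upd: "inj_tab T \<Longrightarrow> x \<notin> ran T \<Longrightarrow> inj_tab (T(c \<mapsto> x))"
  unfolding inj_tab_def ran_def by auto

lemma left_justified_upd_mem: "left_justified T \<Longrightarrow> c \<in> dom T \<Longrightarrow> left_justified (T(c \<mapsto> x))"
  unfolding left_justified_def by (metis dom_upd_mem)

lemma left_justified_upd_end:
  assumes "left_justified T"
  shows "left_justified (T((i, Suc (rowlen (dom T) i)) \<mapsto> x))" (is "left_justified ?T")
proof -
  have fin: "finite (dom T)" using assms by (simp add: left_justified_def)
  have "{j. (a, j) \<in> dom ?T} = {1..rowlen (dom ?T) a}" for a
  proof -
    have *: "{j. (a, j) \<in> dom ?T} = {1..if a = i then Suc (rowlen (dom T) a) else rowlen (dom T) a}"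
      using left_justified_mem[OF assms] by auto
    then show ?thesis unfolding rowlen_def[of "dom ?T"] * by simp
  qed
  then show ?thesis using fin unfolding left_justified_def by simp
qed

text \<open>Fuel is adequate as long as it exceeds the number of entries in the rows still to be visited.\<close>

definition below :: "tableau \<Rightarrow> nat \<Rightarrow> cell set" where
  "below T i = {c \<in> dom T. i \<le> fst c}"

lemma card_below_Suc:
  assumes "finite (dom T)" "(i, j) \<in> dom T"
  shows "card (below T (Suc i)) < card (below T i)"
proof (rule psubset_card_mono)
  show "finite (below T i)" using assms(1) by (simp add: below_def)
  have "(i, j) \<in> below T i - below T (Suc i)" using assms by (simp add: below_def)
  moreover have "below T (Suc i) \<subseteq> below T i" by (auto simp: below_def)
  ultimately show "below T (Suc i) \<subset> below T i" by blast
qed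

text \<open>A new largest entry \<open>N\<close> in box \<open>b\<close> only matters when the bumping path ends in \<open>b\<close>;
  then \<open>N\<close> is bumped to the end of the next row. This is local rule F1 respectively F2.\<close>

lemma row_ins_aux_extend:
  assumes "card (below T i) < n" "card (below (T(b \<mapsto> N)) i) < m"
    and "inj_tab T" "left_justified T" "x \<notin> ran T" "\<forall>v\<in>ran T. v < N" "x < N"
    and "b = (p, Suc (rowlen (dom T) p))"
  shows "\<exists>a\<ge>i. dom (row_ins_aux n T i x) = insert (a, Suc (rowlen (dom T) a)) (dom T)
    \<and> row_ins_aux m (T(b \<mapsto> N)) i x
      = (row_ins_aux n T i x)((if p \<noteq> a then b else (Suc p, Suc (rowlen (dom T) (Suc p)))) \<mapsto> N)"
  using assms
proof (induction n arbitrary: T i x m)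
  case 0
  then show ?case by simp
next
  case (Suc n)
  then obtain m' where m: "m = Suc m'" by (cases m) auto
  have inj: "inj_tab T" and lj: "left_justified T" using Suc.prems by auto
  have fin: "finite (dom T)" using lj by (simp add: left_justified_def)
  have bT: "b \<notin> dom T" using left_justified_mem[OF lj, of p "Suc (rowlen (dom T) p)"] Suc.prems(8) by auto
  have NT: "N \<notin> ran T" using Suc.prems(6) by auto
  have inj': "inj_tab (T(b \<mapsto> N))" by (rule inj_tab_upd[OF inj NT])
  have lj': "left_justified (T(b \<mapsto> N))"
    unfolding Suc.prems(8) by (rule left_justified_upd_end[OF lj])
  have vals: "row_vals (T(b \<mapsto> N)) a = (if a = p then insert N (row_vals T p) else row_vals T a)" for a
    unfolding Suc.prems(8) by (rule row_vals_upd) (use bT Suc.prems(8) in \<open>simp add: domIff\<close>)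
  have valsN: "v < N" if "v \<in> row_vals T a" for v a
    using that Suc.prems(6) by (auto simp: row_vals_def ran_def)
  show ?case
  proof (cases "\<forall>v\<in>row_vals T i. v < x")
    case True
    have P: "row_ins_aux (Suc n) T i x = T((i, Suc (rowlen (dom T) i)) \<mapsto> x)"
      by (rule row_ins_aux_end[OF _ inj lj True]) simp
    show ?thesis
    proof (intro exI[of _ i] conjI)
      show "dom (row_ins_aux (Suc n) T i x) = insert (i, Suc (rowlen (dom T) i)) (dom T)"
        unfolding P by simp
      show "row_ins_aux m (T(b \<mapsto> N)) i x
        = (row_ins_aux (Suc n) T i x)((if p \<noteq> i then b else (Suc p, Suc (rowlen (dom T) (Suc p)))) \<mapsto> N)"
      proof (cases "p = i")
        case False
        have r: "rowlen (dom (T(b \<mapsto> N))) i = rowlen (dom T) i"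
          using rowlen_insert_other[of b i "dom T"] False Suc.prems(8) by simp
        have "row_ins_aux m (T(b \<mapsto> N)) i x = T(b \<mapsto> N, (i, Suc (rowlen (dom (T(b \<mapsto> N))) i)) \<mapsto> x)"
          by (rule row_ins_aux_end[OF _ inj' lj']) (use True vals False m in auto)
        then show ?thesis unfolding P r using False Suc.prems(8) by (auto simp: fun_upd_twist)
      next
        case p: True
        have "row_ins_aux m (T(b \<mapsto> N)) i x = row_ins_aux m' (T(b \<mapsto> N, (i, Suc (rowlen (dom T) p)) \<mapsto> x)) (Suc i) N"
          unfolding m
        proof (rule row_ins_aux_bump[OF inj'])
          show "(T(b \<mapsto> N)) (i, Suc (rowlen (dom T) p)) = Some N" using p Suc.prems(8) by simp
          show "x < N" by fact
          show "N \<le> w" if "w \<in> row_vals (T(b \<mapsto> N)) i" "x < w" for w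
            using that vals p True by force
          show "finite (row_vals (T(b \<mapsto> N)) i)" by (rule finite_row_vals[OF lj'])
        qed
        also have "T(b \<mapsto> N, (i, Suc (rowlen (dom T) p)) \<mapsto> x) = T(b \<mapsto> x)"
          using p Suc.prems(8) by simp
        also have "row_ins_aux m' (T(b \<mapsto> x)) (Suc i) N
          = T(b \<mapsto> x, (Suc i, Suc (rowlen (dom (T(b \<mapsto> x))) (Suc i))) \<mapsto> N)"
        proof (rule row_ins_aux_end)
          \<comment> \<open>Box \<open>b\<close> itself counts among the entries still to be
            visited, so fuel is left for the second step that places \<open>N\<close>.\<close>
          have "b \<in> below (T(b \<mapsto> N)) i" using p Suc.prems(8) by (simp add: below_def)
          moreover have "finite (below (T(b \<mapsto> N)) i)" using fin by (simp add: below_def)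
          ultimately have "0 < card (below (T(b \<mapsto> N)) i)" using card_gt_0_iff by blast
          then show "0 < m'" using Suc.prems(2) m by linarith
          show "inj_tab (T(b \<mapsto> x))" by (rule inj_tab_upd[OF inj Suc.prems(5)])
          show "left_justified (T(b \<mapsto> x))" unfolding Suc.prems(8) by (rule left_justified_upd_end[OF lj])
          show "\<forall>v\<in>row_vals (T(b \<mapsto> x)) (Suc i). v < N"
            using valsN[of _ "Suc i"] p Suc.prems(8) by (auto simp: row_vals_def)
        qed
        also have "rowlen (dom (T(b \<mapsto> x))) (Suc i) = rowlen (dom T) (Suc i)"
          using rowlen_insert_other[of b "Suc i" "dom T"] p Suc.prems(8) by simp
        finally show ?thesis by (simp only: P p Suc.prems(8) simp_thms if_False)
      qed
    qed simp
  next
    case False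
    define V where "V = {v \<in> row_vals T i. x < v}"
    have xv: "x \<notin> row_vals T i" using Suc.prems(5) by (auto simp: row_vals_def ran_def)
    have "finite V" unfolding V_def using finite_row_vals[OF lj] by simp
    moreover have "V \<noteq> {}" unfolding V_def using False xv by (auto simp: not_less le_less)
    ultimately have minV: "Min V \<in> V" "\<And>w. w \<in> V \<Longrightarrow> Min V \<le> w" by auto
    define v where "v = Min V"
    obtain j where j: "T (i, j) = Some v" using minV(1) by (auto simp: v_def V_def row_vals_def)
    have xv': "x < v" using minV(1) by (simp add: v_def V_def)
    have vN: "v < N" using j valsN[of v i] by (auto simp: row_vals_def)
    have jb: "(i, j) \<noteq> b" using j bT by auto
    let ?U = "T((i, j) \<mapsto> x)"
    have ijT: "(i, j) \<in> dom T" using j by auto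
    have domU: "dom ?U = dom T" by (rule dom_upd_mem[OF ijT])
    have 1: "row_ins_aux (Suc n) T i x = row_ins_aux n ?U (Suc i) v"
      by (rule row_ins_aux_bump[OF inj j xv'])
        (use minV(2) finite_row_vals[OF lj] in \<open>auto simp: v_def V_def\<close>)
    have "row_ins_aux (Suc m') (T(b \<mapsto> N)) i x = row_ins_aux m' (T(b \<mapsto> N, (i, j) \<mapsto> x)) (Suc i) v"
    proof (rule row_ins_aux_bump[OF inj'])
      show "(T(b \<mapsto> N)) (i, j) = Some v" using j jb by simp
      show "v \<le> w" if "w \<in> row_vals (T(b \<mapsto> N)) i" "x < w" for w
        using that vN minV(2)[of w] by (auto simp: vals V_def v_def split: if_splits)
    qed (use xv' finite_row_vals[OF lj'] in auto)
    moreover have "T(b \<mapsto> N, (i, j) \<mapsto> x) = ?U(b \<mapsto> N)" using jb by (simp add: fun_upd_twist)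
    ultimately have 2: "row_ins_aux m (T(b \<mapsto> N)) i x = row_ins_aux m' (?U(b \<mapsto> N)) (Suc i) v"
      unfolding m by simp
    have "\<exists>a\<ge>Suc i. dom (row_ins_aux n ?U (Suc i) v) = insert (a, Suc (rowlen (dom ?U) a)) (dom ?U)
      \<and> row_ins_aux m' (?U(b \<mapsto> N)) (Suc i) v
        = (row_ins_aux n ?U (Suc i) v)((if p \<noteq> a then b else (Suc p, Suc (rowlen (dom ?U) (Suc p)))) \<mapsto> N)"
    proof (rule Suc.IH)
      show "card (below ?U (Suc i)) < n"
        using card_below_Suc[OF fin ijT] Suc.prems(1) domU by (simp add: below_def)
      show "card (below (?U(b \<mapsto> N)) (Suc i)) < m'"
      proof -
        have "card (below (T(b \<mapsto> N)) (Suc i)) < card (below (T(b \<mapsto> N)) i)"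
          by (rule card_below_Suc) (use fin ijT in auto)
        moreover have "card (below (T(b \<mapsto> N)) i) < Suc m'" using Suc.prems(2) unfolding m .
        moreover have "below (?U(b \<mapsto> N)) (Suc i) = below (T(b \<mapsto> N)) (Suc i)"
          using domU by (simp add: below_def)
        ultimately show ?thesis by simp
      qed
      show "inj_tab ?U" by (rule inj_tab_upd[OF inj Suc.prems(5)])
      show "left_justified ?U" by (rule left_justified_upd_mem[OF lj ijT])
      show "v \<notin> ran ?U" using inj_tabD[OF inj j] xv' by (auto simp: ran_def split: if_splits)
      show "\<forall>v\<in>ran ?U. v < N" using Suc.prems(6,7) by (auto simp: ran_def split: if_splits)
      show "b = (p, Suc (rowlen (dom ?U) p))" using Suc.prems(8) domU by simp
    qed (rule vN)
    then show ?thesis unfolding 1 2 domU using Suc_leD by blast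
  qed
qed

lemma below_1_card:
  assumes "finite (dom T)"
  shows "card (below T 1) < Suc (card (dom T))"
  unfolding below_def using assms by (simp add: card_mono less_Suc_eq_le)

text \<open>Induction on the largest possible entry. At step \<open>x\<close> all entries present
  are smaller, so insertion stops in the first row, as F3 says. Afterwards
  \<open>row_ins_aux_extend\<close> decides where the next entry goes, in the same two cases as F1
  and F2.\<close>

lemma tab_of_seq_rins:
  assumes "growth e n" "1 \<le> x" "x \<le> n \<longrightarrow> fresh e n x"
  shows "tab_of_seq (rins e x) n =
    (if x \<le> n then row_insert (tab_of_seq e n) x else tab_of_seq e n)"
  using assms
proof (induction n)
  case (Suc n)
  let ?T = "tab_of_seq e n"
  note g = Suc.prems(1)
  note g' = growth_SucD[OF g]
  note inj = inj_tab_of_seq[OF g'] and lj = left_justified_tab_of_seq[OF g']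
  have dT: "dom ?T = e n" by (rule dom_tab_of_seq[OF g'])
  have valsT: "\<And>v. v \<in> ran ?T \<Longrightarrow> v < Suc n" by (auto simp: ran_tab_of_seq[OF g'])
  consider "Suc n < x" | "x = Suc n" | "x \<le> n" by linarith
  then show ?case
  proof cases
    case 1
    have "rins e x k = e k" if "k \<le> Suc n" for k
      using that
    proof (induction k)
      case 0
      then show ?case using g by (simp add: growth_def)
    next
      case (Suc k)
      then show ?case using 1 fwd_rule_stay[OF growth_step[OF g, of k]] by simp
    qed
    then have "tab_of_seq (rins e x) (Suc n) = tab_of_seq e (Suc n)"
      by (intro tab_of_seq_cong) simp
    then show ?thesis using 1 by simp
  next
    case 2
    have fr: "fresh e (Suc n) x" using Suc.prems 2 by simp
    then have en: "e (Suc n) = e n" using 2 by (simp add: fresh_def)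
    have bef: "rins e x k = e k" if "k \<le> n" for k
      using rins_before[OF g fr, of k] that 2 by simp
    have r: "rins e x (Suc n) = insert (1, Suc (rowlen (e n) 1)) (rins e x n)"
      using 2 bef[of n] en fwd_rule_cross[of "e n"] by simp
    have "(1, Suc (rowlen (e n) 1)) \<notin> e n"
      using addable_first_row[OF growth_partition[OF g', of n]] by (simp add: addable_def)
    then have "tab_of_seq (rins e x) (Suc n) = (tab_of_seq (rins e x) n)((1, Suc (rowlen (e n) 1)) \<mapsto> Suc n)"
      using tab_of_seq_add[of "rins e x", OF r] bef[of n] by simp
    also have "tab_of_seq (rins e x) n = ?T" using bef by (intro tab_of_seq_cong) simp
    also have "?T((1, Suc (rowlen (e n) 1)) \<mapsto> Suc n) = row_insert ?T x"
    proof -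
      have "\<forall>v\<in>row_vals ?T 1. v < x" using valsT 2 by (auto simp: row_vals_def ran_def)
      then show ?thesis
        unfolding row_insert_def
        using row_ins_aux_end[OF _ inj lj, of "Suc (card (dom ?T))" 1 x] dT 2
        by (simp del: row_ins_aux.simps)
    qed
    finally show ?thesis using 2 en by simp
  next
    case 3
    have fr: "fresh e (Suc n) x" and fr': "fresh e n x" using Suc.prems 3 by (auto simp: fresh_def)
    have IH: "tab_of_seq (rins e x) n = row_insert ?T x" using Suc.IH[OF g'] fr' 3 Suc.prems by simp
    note gr = growth_rins[OF g' fr']
    obtain r where r: "addable (e n) r" "rins e x n = insert r (e n)"
      using rins_after[OF g' fr' 3] by blast
    have re: "r \<notin> e n" using r by (simp add: addable_def)
    show ?thesis using growth_step[OF g, of n, simplified]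
    proof (cases rule: grow_cases)
      case 1
      have "rins e x (Suc n) = rins e x n"
        using 1 3 fwd_rule_same[of "e n" "rins e x n"] growI_addable[OF r(1)] r(2) by simp
      then show ?thesis using 1 IH 3 by simp
    next
      case (2 b)
      have be: "b \<notin> e n" using 2 by (simp add: addable_def)
      have b: "b = (fst b, Suc (rowlen (dom ?T) (fst b)))"
        using addable_rowlen[OF 2(1)] dT by (simp add: prod_eq_iff)
      let ?b' = "(Suc (fst b), Suc (rowlen (dom ?T) (Suc (fst b))))"
      have T': "tab_of_seq e (Suc n) = ?T(b \<mapsto> Suc n)" by (rule tab_of_seq_add[OF 2(2) be])
      have fin: "finite (dom ?T)" using lj by (simp add: left_justified_def)
      have "\<exists>a\<ge>1. dom (row_insert ?T x) = insert (a, Suc (rowlen (dom ?T) a)) (dom ?T)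
        \<and> row_insert (?T(b \<mapsto> Suc n)) x
          = (row_insert ?T x)((if fst b \<noteq> a then b else ?b') \<mapsto> Suc n)"
        unfolding row_insert_def
        by (rule row_ins_aux_extend[OF _ _ inj lj _ _ _ b])
          (use fin below_1_card[of ?T] below_1_card[of "?T(b \<mapsto> Suc n)"] valsT 3 fr'
            in \<open>auto simp: fresh_iff[OF g'] simp del: One_nat_def\<close>)
      then obtain a where a: "dom (row_insert ?T x) = insert (a, Suc (rowlen (dom ?T) a)) (dom ?T)"
        "row_insert (?T(b \<mapsto> Suc n)) x = (row_insert ?T x)((if fst b \<noteq> a then b else ?b') \<mapsto> Suc n)"
        by blast
      \<comment> \<open>Comparing domains through the induction hypothesis identifies the row
        \<open>a\<close> in which the bumping ends with the row of the box \<open>r\<close> that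
        separates the two chains.\<close>
      have "insert r (e n) = insert (a, Suc (rowlen (dom ?T) a)) (e n)"
        using a(1) dom_tab_of_seq[OF gr] r(2) IH dT by simp
      then have ra: "r = (a, Suc (rowlen (dom ?T) a))" using re by auto
      have "tab_of_seq (rins e x) (Suc n) = (tab_of_seq (rins e x) n)((if fst b \<noteq> a then b else ?b') \<mapsto> Suc n)"
      proof (cases "fst b = a")
        case True
        then have rb: "r = b" using addable_same_row[OF r(1) 2(1)] ra by simp
        have *: "rins e x (Suc n) = insert ?b' (rins e x n)"
          using fwd_rule_bump[OF 2(1)] r(2) 2(2) rb 3 dT by simp
        have "?b' \<notin> rins e x n" using addable_next_row[OF 2(1)] r(2) rb dT by (simp add: addable_def)
        then show ?thesis using tab_of_seq_add[of "rins e x", OF *] True by simp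
      next
        case False
        then have rb: "r \<noteq> b" using ra by auto
        have *: "rins e x (Suc n) = insert b (rins e x n)"
          using fwd_rule_diff[OF re be rb] r(2) 2(2) 3 by auto
        have "b \<notin> rins e x n" using r(2) be rb by auto
        then show ?thesis using tab_of_seq_add[of "rins e x", OF *] False by simp
      qed
      then show ?thesis unfolding T' a(2) IH using 3 by simp
    qed
  qed
qed (simp)

section \<open>Transposition and column operations\<close>

definition tr :: "tableau \<Rightarrow> tableau" where
  "tr T = (\<lambda>c. T (prod.swap c))"

lemma tr_apply [simp]: "tr T (i, j) = T (j, i)"
  by (simp add: tr_def)

lemma tr_tr [simp]: "tr (tr T) = T"
  by (simp add: tr_def)

lemma tr_upd: "tr (T((i, j) := v)) = (tr T)((j, i) := v)"
  by (rule ext) (auto simp: tr_def)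

lemma tr_empty [simp]: "tr Map.empty = Map.empty"
  by (simp add: tr_def)

lemma dom_tr: "dom (tr T) = conj (dom T)"
  by auto

lemma ran_tr [simp]: "ran (tr T) = ran T"
  by (auto simp: ran_def)

lemma col_ins_aux_tr: "col_ins_aux n (tr T) c x = tr (row_ins_aux n T c x)"
proof (induction n arbitrary: T c x)
  case (Suc n)
  then show ?case by (auto simp: Let_def tr_upd[symmetric] simp del: fun_upd_apply)
qed simp

lemma col_insert_tr: "col_insert (tr T) x = tr (row_insert T x)"
  unfolding col_insert_def row_insert_def dom_tr card_conj by (rule col_ins_aux_tr)

lemma tab_of_seq_conj: "growth e n \<Longrightarrow> tab_of_seq (\<lambda>k. conj (e k)) n = tr (tab_of_seq e n)"
proof (induction n)
  case (Suc n)
  note IH = Suc.IH[OF growth_SucD[OF Suc.prems]]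
  show ?case using growth_step[OF Suc.prems, of n, simplified]
  proof (cases rule: grow_cases)
    case 1
    then show ?thesis using IH by simp
  next
    case (2 b)
    obtain i j where b: "b = (i, j)" by force
    have n: "b \<notin> e n" using 2 by (simp add: addable_def)
    show ?thesis
      unfolding tab_of_seq_add[OF 2(2) n]
      using tab_of_seq_add[of "\<lambda>k. conj (e k)" n "(j, i)"] IH 2(2) n b
      by (simp add: tr_upd del: tab_of_seq.simps fun_upd_apply)
  qed
qed simp

definition cins :: "(nat \<Rightarrow> cell set) \<Rightarrow> nat \<Rightarrow> nat \<Rightarrow> cell set" where
  "cins e x k = conj (rins (\<lambda>k. conj (e k)) x k)"

lemma fresh_conj [simp]: "fresh (\<lambda>k. conj (e k)) n x \<longleftrightarrow> fresh e n x"
  by (simp add: fresh_def)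

lemma growth_cins: "growth e n \<Longrightarrow> fresh e n x \<Longrightarrow> growth (cins e x) n"
  unfolding cins_def by (simp add: growth_rins)

lemma tab_of_seq_row_insert:
  assumes "growth e n" "fresh e n x"
  shows "tab_of_seq (rins e x) n = row_insert (tab_of_seq e n) x"
  using tab_of_seq_rins[OF assms(1), of x] assms(2) by (simp add: fresh_def)

lemma tab_of_seq_col_insert:
  assumes "growth e n" "fresh e n x"
  shows "tab_of_seq (cins e x) n = col_insert (tab_of_seq e n) x"
proof -
  let ?e = "\<lambda>k. conj (e k)"
  have g: "growth ?e n" "fresh ?e n x" using assms by auto
  have "tab_of_seq (cins e x) n = tr (tab_of_seq (rins ?e x) n)"
    unfolding cins_def by (rule tab_of_seq_conj[OF growth_rins[OF g]])
  also have "\<dots> = col_insert (tr (tab_of_seq ?e n)) x"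
    unfolding col_insert_tr tab_of_seq_row_insert[OF g] ..
  also have "tr (tab_of_seq ?e n) = tab_of_seq e n"
    using tab_of_seq_conj[OF assms(1)] by simp
  finally show ?thesis .
qed

section \<open>Column deletion inverts insertion\<close>

text \<open>\<open>Max\<close> and \<open>THE\<close> say nothing useful without a candidate, so
  this relation records a deletion run that finds one in every column. The third premise of
  \<open>cdel_Suc\<close> makes \<open>v\<close> the maximum and its row unique.\<close>

inductive cdel :: "tableau \<Rightarrow> nat \<Rightarrow> nat \<Rightarrow> nat \<Rightarrow> tableau \<Rightarrow> bool" where
  cdel_0: "cdel T 0 y y T"
| cdel_Suc: "T (i, Suc c) = Some v \<Longrightarrow> v < y
    \<Longrightarrow> (\<And>i' v'. T (i', Suc c) = Some v' \<Longrightarrow> v' < y \<Longrightarrow> i' \<noteq> i \<Longrightarrow> v' < v)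
    \<Longrightarrow> cdel (T((i, Suc c) \<mapsto> y)) c v x T' \<Longrightarrow> cdel T (Suc c) y x T'"

lemma cdel_imp_col_del_aux: "cdel T c y x T' \<Longrightarrow> col_del_aux T c y = (x, T')"
proof (induction rule: cdel.induct)
  case (cdel_Suc T i c v y x T')
  have bound: "w \<le> v" if "T (i', Suc c) = Some w" "w < y" for i' w
    using cdel_Suc(3)[OF that] cdel_Suc(1) that(1) by (cases "i' = i") auto
  have "Max {v. \<exists>i. T (i, Suc c) = Some v \<and> v < y} = v"
  proof (rule Max_eqI)
    show "finite {v. \<exists>i. T (i, Suc c) = Some v \<and> v < y}"
      by (rule finite_subset[of _ "{..<y}"]) auto
  qed (use bound cdel_Suc(1,2) in auto)
  moreover have "(THE i. T (i, Suc c) = Some v) = i"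
    using cdel_Suc(1,2,3) by (intro the_equality) (auto dest: cdel_Suc(3))
  ultimately show ?case using cdel_Suc.IH by (simp add: Let_def del: fun_upd_apply)
qed simp

text \<open>The values carried by the run only decrease from \<open>y\<close>, so \<open>N\<close>
  is never a candidate, and its box is never overwritten since it was empty.\<close>

lemma cdel_extend:
  "cdel T c y x T' \<Longrightarrow> b \<notin> dom T \<Longrightarrow> y < N \<Longrightarrow> cdel (T(b \<mapsto> N)) c y x (T'(b \<mapsto> N))"
proof (induction rule: cdel.induct)
  case (cdel_0 T y)
  show ?case by (rule cdel.cdel_0)
next
  case (cdel_Suc T i c v y x T')
  have ne: "(i, Suc c) \<noteq> b" using cdel_Suc(1) cdel_Suc.prems(1) by auto
  have IH: "cdel (T((i, Suc c) \<mapsto> y, b \<mapsto> N)) c v x (T'(b \<mapsto> N))"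
    by (rule cdel_Suc.IH) (use ne cdel_Suc in auto)
  show ?case
  proof (rule cdel.cdel_Suc)
    show "(T(b \<mapsto> N)) (i, Suc c) = Some v" using ne cdel_Suc(1) by simp
    show "cdel (T(b \<mapsto> N, (i, Suc c) \<mapsto> y)) c v x (T'(b \<mapsto> N))"
      using IH ne by (simp add: fun_upd_twist)
    show "v' < v" if "(T(b \<mapsto> N)) (i', Suc c) = Some v'" "v' < y" "i' \<noteq> i" for i' v'
      using that cdel_Suc(3) cdel_Suc.prems(2) by (auto split: if_splits)
  qed (rule cdel_Suc(2))
qed

text \<open>Here \<open>v\<close> is the entry that came to rest in the new box, and
  \<open>i - 1\<close> columns remain to be crossed on the way back to \<open>x\<close>. A later
  entry placed elsewhere is harmless by \<open>cdel_extend\<close>. If it competes for the new box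
  it is bumped onwards, and the deletion acquires one more step in front, which puts it back and
  releases \<open>v\<close>.\<close>

lemma cdel_tab_of_seq_rins:
  assumes "growth e n" "fresh e n x"
  shows "\<exists>i j v. rins e x n = insert (i, j) (e n) \<and> (i, j) \<notin> e n
    \<and> tab_of_seq (rins e x) n (i, j) = Some v
    \<and> cdel ((tr (tab_of_seq (rins e x) n))((j, i) := None)) (i - 1) v x (tr (tab_of_seq e n))"
  using assms
proof (induction n)
  case 0
  then show ?case by (auto simp: fresh_def)
next
  case (Suc n)
  note g = Suc.prems(1) and fr = Suc.prems(2)
  note g' = growth_SucD[OF g]
  note gr = growth_rins[OF g fr]
  let ?f = "rins e x"
  let ?T = "tab_of_seq e n" and ?P = "tab_of_seq ?f n"
  have dT: "dom ?T = e n" by (rule dom_tab_of_seq[OF g'])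
  have dP: "dom ?P = ?f n" by (rule dom_tab_of_seq[OF growth_SucD[OF gr]])
  consider "x = Suc n" | "x \<le> n" using fr by (auto simp: fresh_def le_Suc_eq)
  then show ?case
  proof cases
    case 1
    let ?j = "Suc (rowlen (e n) 1)"
    have en: "e (Suc n) = e n" using fr 1 by (simp add: fresh_def)
    have bef: "?f k = e k" if "k \<le> n" for k using rins_before[OF g fr, of k] that 1 by simp
    have r: "?f (Suc n) = insert (1, ?j) (?f n)"
      using 1 bef[of n] en fwd_rule_cross[of "e n"] by simp
    have ne: "(1, ?j) \<notin> e n"
      using addable_first_row[OF growth_partition[OF g', of n]] by (simp add: addable_def)
    have "tab_of_seq ?f (Suc n) = ?P((1, ?j) \<mapsto> Suc n)"
      using tab_of_seq_add[of ?f, OF r] bef[of n] ne by simp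
    also have "?P = ?T" using bef by (intro tab_of_seq_cong) simp
    finally have P: "tab_of_seq ?f (Suc n) = ?T((1, ?j) \<mapsto> Suc n)" .
    have "?T (1, ?j) = None" using ne dT by auto
    then have "(?T((1, ?j) \<mapsto> Suc n))((1, ?j) := None) = ?T" by (auto simp: fun_upd_idem)
    then have "(tr (tab_of_seq ?f (Suc n)))((?j, 1) := None) = tr (tab_of_seq e (Suc n))"
      unfolding P tr_upd[symmetric] using en by simp
    then have "cdel ((tr (tab_of_seq ?f (Suc n)))((?j, 1) := None)) (1 - 1) x x (tr (tab_of_seq e (Suc n)))"
      using cdel_0 by simp
    moreover have "tab_of_seq ?f (Suc n) (1, ?j) = Some x" unfolding P using 1 by simp
    moreover have "?f (Suc n) = insert (1, ?j) (e (Suc n))" using r en bef[of n] by simp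
    ultimately show ?thesis using ne en by metis
  next
    case 2
    have fr': "fresh e n x" using fr 2 by (simp add: fresh_def)
    obtain i j v where IH: "?f n = insert (i, j) (e n)" "(i, j) \<notin> e n" "?P (i, j) = Some v"
      "cdel ((tr ?P)((j, i) := None)) (i - 1) v x (tr ?T)"
      using Suc.IH[OF g' fr'] by blast
    obtain a where "addable (e n) a" "?f n = insert a (e n)"
      using rins_after[OF g' fr' 2] by blast
    then have r: "addable (e n) (i, j)"
      using IH(1,2) by (metis insertI1 insertE)
    have i1: "1 \<le> i" using r growth_partition[OF g', of n] by (simp add: addable_iff)
    have vN: "v < Suc n" using IH(3) by (simp add: tab_of_seq_iff[OF growth_SucD[OF gr]] del: tab_of_seq.simps)
    show ?thesis using growth_step[OF g, of n, simplified]
    proof (cases rule: grow_cases)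
      case 1
      have "?f (Suc n) = ?f n"
        using 1 2 fwd_rule_same[of "e n" "?f n"] growI_addable[OF r] IH(1) by simp
      then have "tab_of_seq ?f (Suc n) = ?P" "tab_of_seq e (Suc n) = ?T" "?f (Suc n) = ?f n"
        using 1 by simp_all
      then show ?thesis using IH 1(1) by metis
    next
      case (2 b)
      obtain p q where b: "b = (p, q)" by force
      have be: "b \<notin> e n" using 2 by (simp add: addable_def)
      have T': "tab_of_seq e (Suc n) = ?T(b \<mapsto> Suc n)" by (rule tab_of_seq_add[OF 2(2) be])
      show ?thesis
      proof (cases "b = (i, j)")
        case False
        have f: "?f (Suc n) = insert b (?f n)"
          using fwd_rule_diff[OF IH(2) be] IH(1) 2(2) False \<open>x \<le> n\<close> by auto
        have bf: "b \<notin> ?f n" using IH(1) be False by auto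
        have P': "tab_of_seq ?f (Suc n) = ?P(b \<mapsto> Suc n)"
          by (rule tab_of_seq_add[of ?f, OF f bf])
        have "cdel ((tr ?P)((j, i) := None, (q, p) \<mapsto> Suc n)) (i - 1) v x ((tr ?T)((q, p) \<mapsto> Suc n))"
          by (rule cdel_extend[OF IH(4) _ vN]) (use bf b dP in auto)
        moreover have "(tr ?P)((j, i) := None, (q, p) \<mapsto> Suc n) = (tr (tab_of_seq ?f (Suc n)))((j, i) := None)"
          unfolding P' b tr_upd using False b by (auto simp: fun_upd_twist)
        moreover have "(tr ?T)((q, p) \<mapsto> Suc n) = tr (tab_of_seq e (Suc n))"
          unfolding T' b tr_upd ..
        moreover have "tab_of_seq ?f (Suc n) (i, j) = Some v" unfolding P' using IH(3) False by auto
        moreover have "?f (Suc n) = insert (i, j) (e (Suc n))" using f IH(1) 2(2) by auto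
        moreover have "(i, j) \<notin> e (Suc n)" using 2(2) IH(2) False by auto
        ultimately show ?thesis by metis
      next
        case True
        let ?j' = "Suc (rowlen (e n) (Suc i))"
        have f: "?f (Suc n) = insert (Suc i, ?j') (?f n)"
          using fwd_rule_bump[OF r] IH(1) 2(2) True \<open>x \<le> n\<close> by simp
        have bf: "(Suc i, ?j') \<notin> ?f n"
          using addable_next_row[OF r] IH(1) by (simp add: addable_def)
        have P': "tab_of_seq ?f (Suc n) = ?P((Suc i, ?j') \<mapsto> Suc n)"
          by (rule tab_of_seq_add[of ?f, OF f bf])
        have "?P (Suc i, ?j') = None" using bf dP by auto
        then have P'': "(tr (tab_of_seq ?f (Suc n)))((?j', Suc i) := None) = tr ?P"
          unfolding P' tr_upd[symmetric] by (simp add: fun_upd_idem)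
        obtain i0 where i0: "i = Suc i0" using i1 by (cases i) auto
        \<comment> \<open>Refilling the emptied box with \<open>Suc n\<close> gives exactly the
          tableau after the first replacement of the longer deletion. That \<open>v\<close> is the
          entry replaced follows because \<open>(i, j)\<close> ends its row in \<open>?f n\<close>,
          so \<open>v\<close> is the largest entry there.\<close>
        have "cdel ((tr ?P)((j, i) := None, (j, i) \<mapsto> Suc n)) (i - 1) v x ((tr ?T)((j, i) \<mapsto> Suc n))"
          by (rule cdel_extend[OF IH(4) _ vN]) simp
        then have "cdel (tr ?P) i (Suc n) x ((tr ?T)((j, i) \<mapsto> Suc n))"
          unfolding i0
        proof (intro cdel_Suc[of _ j i0 v])
          fix j' v'
          assume *: "tr ?P (j', Suc i0) = Some v'" "j' \<noteq> j"
          then have P: "?P (i, j') = Some v'" using i0 by simp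
          then have "(i, j') \<in> ?f n" using dP by auto
          then have "(i, j') \<in> e n" using IH(1) *(2) by auto
          then have "j' \<le> j"
            using addable_rowlen[OF r] partition_mem_iff[OF growth_partition[OF g', of n]] by simp
          then show "v' < v" using tab_of_seq_less[OF growth_SucD[OF gr] P IH(3)] *(2) by simp
        qed (use IH(3) vN i0 in simp_all)
        moreover have "(tr ?T)((j, i) \<mapsto> Suc n) = tr (tab_of_seq e (Suc n))"
          unfolding T' True tr_upd ..
        ultimately have "cdel ((tr (tab_of_seq ?f (Suc n)))((?j', Suc i) := None)) (Suc i - 1) (Suc n) x
            (tr (tab_of_seq e (Suc n)))"
          unfolding P'' by simp
        moreover have "tab_of_seq ?f (Suc n) (Suc i, ?j') = Some (Suc n)" unfolding P' by simp
        moreover have "?f (Suc n) = insert (Suc i, ?j') (e (Suc n))" using f IH(1) 2(2) True by auto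
        moreover have "(Suc i, ?j') \<notin> e (Suc n)" using 2(2) True bf IH(1) by auto
        ultimately show ?thesis by metis
      qed
    qed
  qed
qed

lemma col_delete_tab_of_seq_rins:
  assumes "growth e n" "fresh e n x" "rins e x n = insert (i, j) (e n)" "(i, j) \<notin> e n"
  shows "col_delete (tr (tab_of_seq (rins e x) n)) (j, i) = (x, tr (tab_of_seq e n))"
proof -
  obtain i' j' v where *: "rins e x n = insert (i', j') (e n)" "(i', j') \<notin> e n"
    "tab_of_seq (rins e x) n (i', j') = Some v"
    "cdel ((tr (tab_of_seq (rins e x) n))((j', i') := None)) (i' - 1) v x (tr (tab_of_seq e n))"
    using cdel_tab_of_seq_rins[OF assms(1,2)] by blast
  have "(i', j') = (i, j)" using *(1,2) assms(3,4) by blast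
  then show ?thesis
    using *(3) cdel_imp_col_del_aux[OF *(4)] by (simp add: col_delete_def)
qed

section \<open>Row and column insertion commute\<close>

definition fwdc :: "cell set \<Rightarrow> cell set \<Rightarrow> cell set \<Rightarrow> bool \<Rightarrow> cell set" where
  "fwdc D E F c = conj (fwd_rule (conj D) (conj E) (conj F) c)"

lemma cins_0: "cins e x 0 = {}"
  by (simp add: cins_def)

lemma cins_Suc: "cins e x (Suc k) = fwdc (e k) (cins e x k) (e (Suc k)) (Suc k = x)"
  by (simp add: cins_def fwdc_def)

lemma conj_swap_insert: "conj (insert c D) = insert (prod.swap c) (conj D)"
  by (cases c) simp

lemma addable_swap: "addable (conj D) (prod.swap c) \<longleftrightarrow> addable D c"
  by (cases c) simp

lemma fwdc_same: "grow D E \<Longrightarrow> fwdc D E D False = E"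
  by (simp add: fwdc_def fwd_rule_same)

lemma fwdc_diff:
  assumes "b \<notin> D" "c \<notin> D" "b \<noteq> c"
  shows "fwdc D (insert b D) (insert c D) False = insert b (insert c D)"
  using fwd_rule_diff[of "prod.swap b" "conj D" "prod.swap c"] assms
  unfolding fwdc_def conj_swap_insert
  by (cases b; cases c) (auto simp: conj_swap_insert)

lemma fwdc_bump_eq:
  assumes "addable D b" "addable (insert b D) c" "snd c = Suc (snd b)"
  shows "fwdc D (insert b D) (insert b D) False = insert c (insert b D)"
proof -
  have "addable (conj D) (prod.swap b)" "addable (insert (prod.swap b) (conj D)) (prod.swap c)"
    using assms(1,2) by (simp_all only: addable_swap flip: conj_swap_insert)
  then show ?thesis
    using fwd_rule_bump_eq[of "conj D" "prod.swap b" "prod.swap c"] assms(3)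
    by (simp add: fwdc_def conj_swap_insert)
qed

lemma fwdc_grow:
  assumes "grow D E" "grow D F" "c \<Longrightarrow> E = D \<and> F = D"
  shows "grow E (fwdc D E F c)" "grow F (fwdc D E F c)"
  using fwd_rule_grow[of "conj D" "conj E" "conj F" c] assms
  unfolding fwdc_def by (metis conj_conj grow_conj)+

lemma addable_first_col:
  assumes "is_partition D"
  obtains c where "addable D c" "snd c = 1"
proof -
  have "is_partition (conj D)" using assms by simp
  from addable_first_row[OF this] show thesis using that by (auto simp del: One_nat_def)
qed

lemma addable_next_row_ex:
  assumes "addable D b"
  obtains c where "addable (insert b D) c" "fst c = Suc (fst b)"
  using addable_next_row[OF assms] by auto

lemma addable_next_col_ex:
  assumes "addable D b"
  obtains c where "addable (insert b D) c" "snd c = Suc (snd b)"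
proof -
  have "addable (conj D) (prod.swap b)" using assms by (simp only: addable_swap)
  from addable_next_row_ex[OF this] obtain c
    where c: "addable (insert (prod.swap b) (conj D)) c" "fst c = Suc (fst (prod.swap b))" .
  have "addable (conj (insert b D)) (prod.swap (prod.swap c))"
    using c(1) by (simp add: conj_swap_insert)
  then have "addable (insert b D) (prod.swap c)" by (simp only: addable_swap)
  then show thesis using that c(2) by simp
qed

lemma fwdc_cross_eq:
  assumes "addable D c" "snd c = 1"
  shows "fwdc D D D True = insert c D"
proof -
  have 1: "addable (conj D) (prod.swap c)" using assms(1) by (simp only: addable_swap)
  have "(1, Suc (rowlen (conj D) 1)) = prod.swap c"
    using addable_rowlen[OF 1] assms(2) by (cases c) simp
  then show ?thesis by (simp add: fwdc_def fwd_rule_cross conj_swap_insert)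
qed

definition adjacent :: "cell \<Rightarrow> cell \<Rightarrow> bool" where
  "adjacent r s \<longleftrightarrow> s = (Suc (fst r), snd r) \<or> s = (fst r, Suc (snd r))"

text \<open>The four corners are the shapes before any insertion, after the row insertion, after the
  column insertion, and after both. If the two insertions add the same box, the second of them
  puts its own new box next to it.\<close>

definition comm_inv :: "cell set \<Rightarrow> cell set \<Rightarrow> cell set \<Rightarrow> cell set \<Rightarrow> bool" where
  "comm_inv L R C E \<longleftrightarrow>
     (R = L \<and> E = C \<and> grow L C) \<or> (C = L \<and> E = R \<and> grow L R) \<or>
     (\<exists>r c. addable L r \<and> addable L c \<and> r \<noteq> c \<and> R = insert r L \<and> C = insert c L
        \<and> E = insert r (insert c L)) \<or>
     (\<exists>r s. addable L r \<and> adjacent r s \<and> addable (insert r L) s \<and> R = insert r L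
        \<and> C = insert r L \<and> E = insert s (insert r L))"

text \<open>One slice of a cube whose third direction is the chain itself: the face
  \<open>L, R, C, E\<close> moves on to the face over \<open>L'\<close>. Its fourth corner can be
  computed by a column rule from \<open>R, E\<close> or by a row rule from \<open>C, E\<close>; the
  two must agree and \<open>comm_inv\<close> must survive. \<open>px\<close> and \<open>py\<close>
  mark the crosses of the column and of the row insertion.\<close>

definition comm_step :: "cell set \<Rightarrow> cell set \<Rightarrow> cell set \<Rightarrow> cell set \<Rightarrow> cell set \<Rightarrow> bool \<Rightarrow> bool \<Rightarrow> bool" where
  "comm_step L R C E L' px py \<longleftrightarrow>
     fwdc R E (fwd_rule L R L' py) px = fwd_rule C E (fwdc L C L' px) py
     \<and> comm_inv L' (fwd_rule L R L' py) (fwdc L C L' px) (fwd_rule C E (fwdc L C L' px) py)"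

lemma comm_inv_conj_imp: "comm_inv L R C E \<Longrightarrow> comm_inv (conj L) (conj C) (conj R) (conj E)"
proof -
  assume "comm_inv L R C E"
  then consider "R = L" "E = C" "grow L C" | "C = L" "E = R" "grow L R"
    | r c where "addable L r" "addable L c" "r \<noteq> c" "R = insert r L" "C = insert c L"
        "E = insert r (insert c L)"
    | r s where "addable L r" "adjacent r s" "addable (insert r L) s" "R = insert r L"
        "C = insert r L" "E = insert s (insert r L)"
    unfolding comm_inv_def by blast
  then show ?thesis
  proof cases
    case 3
    show ?thesis
      unfolding comm_inv_def
      apply (rule disjI2, rule disjI2, rule disjI1)
      apply (rule exI[of _ "prod.swap c"], rule exI[of _ "prod.swap r"])
      using 3 by (auto simp: conj_swap_insert addable_swap prod_eq_iff)
  next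
    case 4
    have "adjacent (prod.swap r) (prod.swap s)"
      using 4(2) by (auto simp: adjacent_def)
    moreover have "addable (insert (prod.swap r) (conj L)) (prod.swap s)"
      using 4(3) by (metis addable_swap conj_swap_insert)
    ultimately show ?thesis
      unfolding comm_inv_def
      using 4 by (metis addable_swap conj_swap_insert)
  qed (simp_all add: comm_inv_def)
qed

text \<open>Conjugation exchanges the two insertions, so each of the cases below also settles its
  mirror image.\<close>

lemma comm_step_conj:
  assumes "comm_step (conj L) (conj C) (conj R) (conj E) (conj L') py px"
  shows "comm_step L R C E L' px py"
proof -
  have 1: "fwd_rule (conj L) (conj C) (conj L') px = conj (fwdc L C L' px)"
    by (simp add: fwdc_def)
  have 2: "fwdc (conj L) (conj R) (conj L') py = conj (fwd_rule L R L' py)"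
    by (simp add: fwdc_def)
  have 3: "fwd_rule (conj R) (conj E) (conj X) px = conj (fwdc R E X px)" for X
    by (simp add: fwdc_def)
  have 4: "fwdc (conj C) (conj E) (conj X) py = conj (fwd_rule C E X py)" for X
    by (simp add: fwdc_def)
  from assms show ?thesis
    unfolding comm_step_def 1 2 3 4 using comm_inv_conj_imp by fastforce
qed

lemma addable_below_adjacent:
  assumes b: "addable D b" and c: "addable (insert b D) c" and "snd c = snd b"
  shows "fst c = Suc (fst b)"
proof -
  obtain i j where bij: "b = (i, j)" by force
  obtain i' where cij: "c = (i', j)" using assms(3) bij by (cases c) auto
  have D: "is_partition D" and E: "is_partition (insert (i, j) D)"
    using b bij by (auto simp: addable_def)
  have 1: "(i, j) \<notin> D" "1 \<le> i" "1 \<le> j" using b unfolding bij addable_iff[OF D] by auto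
  have 2: "(i', j) \<notin> insert (i, j) D" "1 \<le> i'" "i' = 1 \<or> (i' - 1, j) \<in> insert (i, j) D"
    using c unfolding bij cij addable_iff[OF E] by auto
  have "i < i'"
  proof (rule ccontr)
    assume "\<not> i < i'"
    then have "(i', j) \<in> insert (i, j) D" using partition_down[OF E, of i j i' j] 2 1 by simp
    then show False using 2(1) by blast
  qed
  moreover have "(i' - 1, j) \<notin> D"
  proof
    assume "(i' - 1, j) \<in> D"
    then have "(i, j) \<in> D" using partition_down[OF D, of "i' - 1" j i j] 1 \<open>i < i'\<close> by linarith
    then show False using 1 by blast
  qed
  ultimately show ?thesis using 1(2) 2(3) bij cij by auto
qed

text \<open>The column insertion starts with a box \<open>c\<close> in the first column. If the row
  insertion has already created that very box, both continuations land directly below it: the column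
  cross because the first column is now longer, the row rule because it bumps \<open>c\<close> into
  the next row.\<close>

lemma comm_step_col_cross:
  assumes inv: "comm_inv L R L E"
  shows "comm_step L R L E L True False"
proof -
  have ER: "E = R" and g: "grow L R"
    using inv unfolding comm_inv_def by (auto simp: addable_def grow_refl grow_def)
  have L: "is_partition L" using g by (simp add: grow_def)
  obtain c where c: "addable L c" "snd c = 1" using addable_first_col[OF L] .
  have cL: "c \<notin> L" using c by (simp add: addable_def)
  have R': "fwd_rule L R L False = R" by (rule fwd_rule_same[OF g])
  have C': "fwdc L L L True = insert c L" by (rule fwdc_cross_eq[OF c])
  show ?thesis using g
  proof (cases rule: grow_cases)
    case 1
    then show ?thesis
      unfolding comm_step_def R' C' ER
      using C' fwd_rule_stay[OF growI_addable[OF c(1)]] growI_addable[OF c(1)]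
      by (simp add: comm_inv_def)
  next
    case (2 r)
    have rL: "r \<notin> L" using 2 by (simp add: addable_def)
    show ?thesis
    proof (cases "r = c")
      case False
      have "fwdc R R R True = insert c R"
        using fwdc_cross_eq[of R c] addable_insert_other[OF 2(1) c(1) False] 2(2) c(2) by simp
      moreover have "fwd_rule L R (insert c L) False = insert r (insert c L)"
        using fwd_rule_diff[OF rL cL False] 2(2) by simp
      moreover have "comm_inv L R (insert c L) (insert r (insert c L))"
        unfolding comm_inv_def using 2 c False by blast
      ultimately show ?thesis
        unfolding comm_step_def R' C' ER using 2(2) by (simp add: insert_commute)
    next
      case True
      have "is_partition R" using g by (simp add: grow_def)
      then obtain s where s: "addable R s" "snd s = 1" using addable_first_col by blast
      have s': "addable (insert c L) s" using s 2(2) True by simp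
      have fs: "fst s = Suc (fst c)"
        using addable_below_adjacent[OF c(1) s'] s(2) c(2) by simp
      have "fwdc R R R True = insert s R" by (rule fwdc_cross_eq[OF s])
      moreover have "fwd_rule L R (insert c L) False = insert s (insert c L)"
        using fwd_rule_bump_eq[OF c(1) s' fs] 2(2) True by simp
      moreover have "adjacent c s" using fs s(2) c(2) by (simp add: adjacent_def prod_eq_iff)
      ultimately show ?thesis
        unfolding comm_step_def R' C' ER comm_inv_def using 2(2) True c(1) s' by metis
    qed
  qed
qed

lemma comm_step_trivial_row:
  assumes "grow L C" "grow L L'"
  shows "comm_step L L C C L' False False"
proof -
  have "fwd_rule L L L' False = L'" by (rule fwd_rule_stay[OF assms(2)])
  moreover have "fwd_rule C C (fwdc L C L' False) False = fwdc L C L' False"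
    by (rule fwd_rule_stay[OF fwdc_grow(1)[OF assms]]) simp
  ultimately show ?thesis
    unfolding comm_step_def comm_inv_def using fwdc_grow(2)[OF assms, of False] by simp
qed

text \<open>The chain now takes the box \<open>r\<close> of the row insertion, which bumps it to
  \<open>s\<close> in the next row. The delicate case is \<open>s = c\<close>: both insertions then
  claim \<open>s\<close>. The column rule pushes \<open>s\<close> one column on, the row rule on the
  other side pushes \<open>r\<close> one row down, and both reach the box to the right of
  \<open>s\<close>.\<close>

lemma comm_step_distinct_bump:
  assumes r: "addable L r" and c: "addable L c" and rc: "r \<noteq> c"
  shows "comm_step L (insert r L) (insert c L) (insert r (insert c L)) (insert r L) False False"
proof -
  let ?R = "insert r L"
  obtain s where s: "addable ?R s" "fst s = Suc (fst r)" using addable_next_row_ex[OF r] .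
  have rL: "r \<notin> L" and cL: "c \<notin> L" and sR: "s \<notin> ?R" using r c s by (auto simp: addable_def)
  have cR: "addable ?R c" by (rule addable_insert_other[OF r c rc])
  have cr: "addable (insert c L) r" using addable_insert_other[OF c r] rc by blast
  have R': "fwd_rule L ?R ?R False = insert s ?R" by (rule fwd_rule_bump_eq[OF r s])
  have C': "fwdc L (insert c L) ?R False = insert c ?R" by (rule fwdc_diff[OF cL rL rc[symmetric]])
  have E: "insert r (insert c L) = insert c ?R" by auto
  show ?thesis
  proof (cases "c = s")
    case False
    have "fwdc ?R (insert c ?R) (insert s ?R) False = insert c (insert s ?R)"
      by (rule fwdc_diff) (use cR sR False in \<open>auto simp: addable_def\<close>)
    moreover have "addable (insert r (insert c L)) s"
      unfolding E by (rule addable_insert_other[OF cR s(1) False])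
    then have "fwd_rule (insert c L) (insert r (insert c L)) (insert r (insert c L)) False
      = insert s (insert r (insert c L))"
      by (rule fwd_rule_bump_eq[OF cr _ s(2)])
    moreover have "comm_inv ?R (insert s ?R) (insert c ?R) (insert s (insert c ?R))"
      unfolding comm_inv_def using s(1) cR False by blast
    ultimately show ?thesis
      unfolding comm_step_def R' C' E by (simp add: insert_commute)
  next
    case True
    have L: "is_partition L" and R: "is_partition ?R" and SR: "is_partition (insert s ?R)"
      using r s by (auto simp: addable_def)
    obtain i j where rij: "r = (i, j)" by force
    obtain j' where sij: "s = (Suc i, j')" using s(2) rij by (cases s) auto
    have 1: "(i, j) \<notin> L" "1 \<le> i" "1 \<le> j" using r unfolding rij addable_iff[OF L] by auto
    have 2: "(Suc i, j') \<notin> L" "1 \<le> j'" "(i, j') \<in> L"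
      using c 1(2) unfolding True sij addable_iff[OF L] by auto
    \<comment> \<open>As \<open>s = c\<close> is addable to \<open>L\<close>, the cell above it
      already lies in row \<open>i\<close> of \<open>L\<close>, hence to the left of
      \<open>r\<close>. This leaves room for the box right of \<open>s\<close>.\<close>
    have "j' < j"
    proof (rule ccontr)
      assume "\<not> j' < j"
      then have "(i, j) \<in> L" using partition_down[OF L 2(3), of i j] 1 by simp
      then show False using 1 by blast
    qed
    then have "(i, Suc j') \<in> ?R" using partition_down[OF R, of i j i "Suc j'"] 1 rij by simp
    moreover have "(Suc i, Suc j') \<notin> L"
      using partition_down[OF L, of "Suc i" "Suc j'" "Suc i" j'] 2 by auto
    ultimately have t: "addable (insert s ?R) (Suc i, Suc j')"
      unfolding addable_iff[OF SR] using rij sij by auto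
    have "fwdc ?R (insert s ?R) (insert s ?R) False = insert (Suc i, Suc j') (insert s ?R)"
      by (rule fwdc_bump_eq[OF s(1) t]) (simp add: sij)
    moreover have "addable (insert r (insert c L)) (Suc i, Suc j')" using t True E by simp
    then have "fwd_rule (insert c L) (insert r (insert c L)) (insert r (insert c L)) False
      = insert (Suc i, Suc j') (insert r (insert c L))"
      by (rule fwd_rule_bump_eq[OF cr]) (simp add: rij)
    moreover have "comm_inv ?R (insert s ?R) (insert s ?R) (insert (Suc i, Suc j') (insert s ?R))"
      unfolding comm_inv_def adjacent_def using s(1) t sij by auto
    ultimately show ?thesis
      using R' C' E True unfolding comm_step_def by (simp add: insert_commute)
  qed
qed

text \<open>The row rule sends \<open>r\<close> down to \<open>s\<close>, the column rule sends it
  to some \<open>q\<close> in the next column. On the far side the column rule moves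
  \<open>s\<close> instead, but \<open>s\<close> is in the column of \<open>r\<close>, so it also
  arrives at \<open>q\<close>. The two insertions now own different boxes again.\<close>

lemma comm_step_same_bump:
  assumes r: "addable L r" and s: "addable (insert r L) s" "s = (Suc (fst r), snd r)"
  shows "comm_step L (insert r L) (insert r L) (insert s (insert r L)) (insert r L) False False"
proof -
  let ?R = "insert r L"
  obtain q where q: "addable ?R q" "snd q = Suc (snd r)" using addable_next_col_ex[OF r] .
  have sq: "s \<noteq> q" using s(2) q(2) by auto
  have nR: "s \<notin> ?R" "q \<notin> ?R" using s(1) q(1) by (auto simp: addable_def)
  have R': "fwd_rule L ?R ?R False = insert s ?R" by (rule fwd_rule_bump_eq[OF r s(1)]) (simp add: s)
  have C': "fwdc L ?R ?R False = insert q ?R" by (rule fwdc_bump_eq[OF r q])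
  have "fwdc ?R (insert s ?R) (insert s ?R) False = insert q (insert s ?R)"
    by (rule fwdc_bump_eq[OF s(1) addable_insert_other[OF s(1) q(1) sq]]) (simp add: s(2) q(2))
  moreover have "fwd_rule ?R (insert s ?R) (insert q ?R) False = insert s (insert q ?R)"
    by (rule fwd_rule_diff[OF nR sq])
  moreover have "comm_inv ?R (insert s ?R) (insert q ?R) (insert s (insert q ?R))"
    unfolding comm_inv_def using s(1) q(1) sq by blast
  ultimately show ?thesis unfolding comm_step_def R' C' by (simp add: insert_commute)
qed

text \<open>A cross stands where the chain stalls and its own insertion has not begun, and distinct
  letters never cross at the same step. Without crosses, a new box either hits a box of the
  insertions, which the two bump lemmas treat up to conjugation, or commutes with all of them by
  F1.\<close>

lemma comm_stepI:
  assumes inv: "comm_inv L R C E" and g: "grow L L'"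
    and px: "px \<Longrightarrow> L' = L \<and> C = L" and py: "py \<Longrightarrow> L' = L \<and> R = L" and xy: "\<not> (px \<and> py)"
  shows "comm_step L R C E L' px py"
proof -
  consider (x) "px" "\<not> py" | (y) "\<not> px" "py" | (n) "\<not> px" "\<not> py" using xy by blast
  then show ?thesis
  proof cases
    case x
    then show ?thesis using px comm_step_col_cross inv by auto
  next
    case y
    have "comm_step (conj L) (conj C) (conj L) (conj E) (conj L) True False"
      by (rule comm_step_col_cross) (use comm_inv_conj_imp[OF inv] py y in auto)
    then show ?thesis using comm_step_conj[of L C R E L' py px] y py by simp
  next
    case n
    have L: "is_partition L" using g by (simp add: grow_def)
    have "comm_step L R C E L' False False" using inv[unfolded comm_inv_def]
    proof (elim disjE exE conjE)
      assume "R = L" "E = C" "grow L C"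
      then show ?thesis using comm_step_trivial_row g by simp
    next
      assume "C = L" "E = R" "grow L R"
      then show ?thesis
        using comm_step_conj comm_step_trivial_row[of "conj L" "conj R" "conj L'"] g by simp
    next
      fix r c
      assume rc: "addable L r" "addable L c" "r \<noteq> c" "R = insert r L" "C = insert c L"
        "E = insert r (insert c L)"
      have nL: "r \<notin> L" "c \<notin> L" using rc by (auto simp: addable_def)
      have gRE: "grow R E" using growI_addable[OF addable_insert_other[OF rc(1-3)]] rc(4,6)
        by (simp add: insert_commute)
      have gCE: "grow C E" using growI_addable[OF addable_insert_other[OF rc(2,1)]] rc(3,5,6) by simp
      show ?thesis using g
      proof (cases rule: grow_cases)
        case 1
        have "fwd_rule L R L False = R" "fwdc L C L False = C"
          using fwd_rule_same fwdc_same growI_addable rc by metis+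
        then show ?thesis
          unfolding comm_step_def 1(1) using fwdc_same[OF gRE] fwd_rule_same[OF gCE] inv by simp
      next
        case (2 b)
        have bL: "b \<notin> L" using 2 by (simp add: addable_def)
        consider "b = r" | "b = c" | "b \<noteq> r" "b \<noteq> c" by blast
        then show ?thesis
        proof cases
          case 1
          then show ?thesis using comm_step_distinct_bump[OF rc(1-3)] 2 rc by simp
        next
          case b: 2
          have "comm_step (conj L) (conj C) (conj R) (conj E) (conj L') False False"
            using comm_step_distinct_bump[of "conj L" "prod.swap c" "prod.swap r"] rc 2 b
            by (auto simp: conj_swap_insert addable_swap insert_commute prod_eq_iff)
          then show ?thesis by (rule comm_step_conj)
        next
          case b: 3
          have R': "fwd_rule L R L' False = insert r L'"
            using fwd_rule_diff[OF nL(1) bL] b rc(4) 2(2) by simp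
          have C': "fwdc L C L' False = insert c L'"
            using fwdc_diff[OF nL(2) bL] b rc(5) 2(2) by simp
          have eqs: "E = insert c R" "E = insert r C" "insert r L' = insert b R" "insert c L' = insert b C"
            using rc 2 by auto
          have "fwdc R (insert c R) (insert b R) False = insert c (insert b R)"
            by (rule fwdc_diff) (use rc b nL bL in auto)
          moreover have "fwd_rule C (insert r C) (insert b C) False = insert r (insert b C)"
            by (rule fwd_rule_diff) (use rc b nL bL in auto)
          moreover have "insert c (insert b R) = insert r (insert c L')" "insert r (insert b C) = insert r (insert c L')"
            using rc 2 by auto
          moreover have "comm_inv L' (insert r L') (insert c L') (insert r (insert c L'))"
            unfolding comm_inv_def
            using addable_insert_other[OF 2(1) rc(1)] addable_insert_other[OF 2(1) rc(2)] b rc(3) 2(2)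
            by blast
          ultimately show ?thesis unfolding comm_step_def R' C' using eqs by metis
        qed
      qed
    next
      fix r s
      assume rs: "addable L r" "adjacent r s" "addable (insert r L) s" "R = insert r L"
        "C = insert r L" "E = insert s (insert r L)"
      have nL: "r \<notin> L" "s \<notin> insert r L" using rs by (auto simp: addable_def)
      have gRE: "grow R E" "grow C E" using growI_addable[OF rs(3)] rs by auto
      show ?thesis using g
      proof (cases rule: grow_cases)
        case 1
        have "fwd_rule L R L False = R" "fwdc L C L False = C"
          using fwd_rule_same fwdc_same growI_addable rs by metis+
        then show ?thesis
          unfolding comm_step_def 1(1) using fwdc_same[OF gRE(1)] fwd_rule_same[OF gRE(2)] inv by simp
      next
        case (2 b)
        have bL: "b \<notin> L" using 2 by (simp add: addable_def)
        show ?thesis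
        proof (cases "b = r")
          case True
          show ?thesis
          proof (cases "s = (Suc (fst r), snd r)")
            case s: True
            then show ?thesis using comm_step_same_bump[OF rs(1,3) s] rs 2 True by simp
          next
            case False
            then have s: "s = (fst r, Suc (snd r))" using rs(2) by (simp add: adjacent_def)
            have "addable (insert (prod.swap r) (conj L)) (prod.swap s)"
              using rs(3) by (metis addable_swap conj_swap_insert)
            then have "comm_step (conj L) (conj C) (conj R) (conj E) (conj L') False False"
              using comm_step_same_bump[of "conj L" "prod.swap r" "prod.swap s"] rs 2 True s
              by (simp add: conj_swap_insert addable_swap)
            then show ?thesis by (rule comm_step_conj)
          qed
        next
          case False
          \<comment> \<open>Adding \<open>s\<close> requires its neighbour \<open>r\<close>, which
            is missing from \<open>L\<close>, whereas \<open>b\<close> is addable to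
            \<open>L\<close>.\<close>
          have bs: "b \<noteq> s"
          proof
            assume "b = s"
            then have "addable L s" using 2 by simp
            then show False
              using rs(1,2) nL(1) unfolding adjacent_def
              by (cases r) (auto simp: addable_iff[OF L])
          qed
          have R': "fwd_rule L R L' False = insert b R"
            using fwd_rule_diff[OF nL(1) bL] False rs(4) 2(2) by auto
          have C': "fwdc L C L' False = insert b R"
            using fwdc_diff[OF nL(1) bL] False rs(4,5) 2(2) by auto
          have "fwdc R (insert s R) (insert b R) False = insert s (insert b R)"
            by (rule fwdc_diff) (use rs bs False nL bL in auto)
          moreover have "fwd_rule R (insert s R) (insert b R) False = insert s (insert b R)"
            by (rule fwd_rule_diff) (use rs bs False nL bL in auto)
          moreover have "addable L' r" using addable_insert_other[OF 2(1) rs(1) False] 2(2) by simp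
          moreover have "addable (insert b R) s"
            using addable_insert_other[of R b s] addable_insert_other[OF rs(1) 2(1)] rs(3,4) False bs by auto
          moreover have "insert b R = insert r L'" using rs 2 by auto
          ultimately show ?thesis
            unfolding comm_step_def R' C' comm_inv_def using rs by metis
        qed
      qed
    qed
    then show ?thesis using n by simp
  qed
qed

text \<open>Equality of the two corners alone is not inductive; it is propagated together with the
  relative position of all four shapes.\<close>

lemma rins_cins_commute:
  assumes g: "growth e n" and x: "fresh e n x" and y: "fresh e n y" and xy: "x \<noteq> y"
  shows "k \<le> n \<Longrightarrow> cins (rins e y) x k = rins (cins e x) y k
    \<and> comm_inv (e k) (rins e y k) (cins e x k) (rins (cins e x) y k)"
proof (induction k)
  case 0
  then show ?case using g by (simp add: cins_0 growth_def comm_inv_def grow_refl)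
next
  case (Suc k)
  then have IH: "cins (rins e y) x k = rins (cins e x) y k"
    "comm_inv (e k) (rins e y k) (cins e x k) (rins (cins e x) y k)" by auto
  have "comm_step (e k) (rins e y k) (cins e x k) (rins (cins e x) y k) (e (Suc k)) (Suc k = x) (Suc k = y)"
  proof (rule comm_stepI[OF IH(2)])
    show "grow (e k) (e (Suc k))" using growth_step[OF g] Suc.prems by simp
    show "e (Suc k) = e k \<and> cins e x k = e k" if "Suc k = x"
      using that x rins_before[of "\<lambda>k. conj (e k)" n x k] g by (auto simp: fresh_def cins_def)
    show "e (Suc k) = e k \<and> rins e y k = e k" if "Suc k = y"
      using that y rins_before[of e n y k] g by (auto simp: fresh_def)
  qed (use xy in auto)
  then show ?case unfolding comm_step_def cins_Suc rins.simps IH(1) .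
qed

section \<open>Insertion of words\<close>

definition ptab :: "nat \<Rightarrow> tableau \<Rightarrow> bool" where
  "ptab n T \<longleftrightarrow> (\<exists>e. growth e n \<and> T = tab_of_seq e n)"

lemma ptab_empty: "ptab n Map.empty"
proof -
  have "growth (\<lambda>_. {}) n" by (simp add: growth_def grow_refl)
  moreover have "tab_of_seq (\<lambda>_. {}) n = Map.empty" by (induction n) auto
  ultimately show ?thesis unfolding ptab_def by metis
qed

lemma ptab_tr: "ptab n T \<Longrightarrow> ptab n (tr T)"
  unfolding ptab_def using tab_of_seq_conj growth_conj by metis

lemma ran_row_insert:
  assumes "growth e n" "fresh e n x"
  shows "ran (tab_of_seq (rins e x) n) = insert x (ran (tab_of_seq e n))"
proof -
  have "rins e x v \<noteq> rins e x (v - 1) \<longleftrightarrow> v = x \<or> e v \<noteq> e (v - 1)" if v: "1 \<le> v" "v \<le> n" for v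
  proof -
    obtain k where k: "v = Suc k" using v by (cases v) auto
    have s: "grow (e k) (rins e x k)" "rins e x k = e k \<longleftrightarrow> k < x"
      using rins_step[OF assms, of k] k v by auto
    have "grow (e k) (e v)" using growth_step[OF assms(1)] k v by simp
    moreover have "v = x \<Longrightarrow> rins e x k = e k \<and> e v = e k"
      using s(2) assms(2) k by (auto simp: fresh_def)
    ultimately show ?thesis
      using fwd_rule_grow(4)[OF s(1), of "e v" "v = x"] k by auto
  qed
  then have "v \<in> ran (tab_of_seq (rins e x) n) \<longleftrightarrow> v = x \<or> v \<in> ran (tab_of_seq e n)" for v
    unfolding ran_tab_of_seq[OF assms(1)] ran_tab_of_seq[OF growth_rins[OF assms]]
    using assms(2) unfolding fresh_def by blast
  then show ?thesis by auto
qed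

lemma ptab_row_insert:
  assumes "ptab n T" "1 \<le> x" "x \<le> n" "x \<notin> ran T"
  shows "ptab n (row_insert T x)" "ran (row_insert T x) = insert x (ran T)"
proof -
  obtain e where e: "growth e n" "T = tab_of_seq e n" using assms(1) by (auto simp: ptab_def)
  have fr: "fresh e n x" using fresh_iff[OF e(1)] e(2) assms by simp
  show "ptab n (row_insert T x)" "ran (row_insert T x) = insert x (ran T)"
    using tab_of_seq_row_insert[OF e(1) fr] growth_rins[OF e(1) fr] ran_row_insert[OF e(1) fr] e(2)
    by (auto simp: ptab_def)
qed

lemma ptab_col_insert:
  assumes "ptab n T" "1 \<le> x" "x \<le> n" "x \<notin> ran T"
  shows "ptab n (col_insert T x)" "ran (col_insert T x) = insert x (ran T)"
  using ptab_row_insert[of n "tr T" x] ptab_tr[of n T] ptab_tr[of n "row_insert (tr T) x"]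
    col_insert_tr[of "tr T" x] assms
  by simp_all

lemma row_col_insert_commute:
  assumes "ptab n T" "1 \<le> x" "x \<le> n" "x \<notin> ran T" "1 \<le> y" "y \<le> n" "y \<notin> ran T" "x \<noteq> y"
  shows "row_insert (col_insert T x) y = col_insert (row_insert T y) x"
proof -
  obtain e where e: "growth e n" "T = tab_of_seq e n" using assms(1) by (auto simp: ptab_def)
  have fx: "fresh e n x" and fy: "fresh e n y" using fresh_iff[OF e(1)] e(2) assms by auto
  have gx: "growth (cins e x) n" and gy: "growth (rins e y) n"
    using growth_cins[OF e(1) fx] growth_rins[OF e(1) fy] .
  have cx: "tab_of_seq (cins e x) n = col_insert T x" and ry: "tab_of_seq (rins e y) n = row_insert T y"
    using tab_of_seq_col_insert[OF e(1) fx] tab_of_seq_row_insert[OF e(1) fy] e(2) by auto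
  have fy': "fresh (cins e x) n y"
    using ptab_col_insert(2)[OF assms(1-4)] assms unfolding fresh_iff[OF gx] cx by simp
  have fx': "fresh (rins e y) n x"
    using ptab_row_insert(2)[OF assms(1,5-7)] assms unfolding fresh_iff[OF gy] ry by simp
  have "row_insert (col_insert T x) y = tab_of_seq (rins (cins e x) y) n"
    using tab_of_seq_row_insert[OF gx fy'] cx by simp
  also have "\<dots> = tab_of_seq (cins (rins e y) x) n"
    using rins_cins_commute[OF e(1) fx fy assms(8)] by (intro tab_of_seq_cong) simp
  also have "\<dots> = col_insert (row_insert T y) x"
    using tab_of_seq_col_insert[OF gy fx'] ry by simp
  finally show ?thesis .
qed

definition insertable :: "nat \<Rightarrow> tableau \<Rightarrow> nat list \<Rightarrow> bool" where
  "insertable n T w \<longleftrightarrow> ptab n T \<and> distinct w \<and> set w \<subseteq> {1..n} \<and> set w \<inter> ran T = {}"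

lemma insertable_Cons:
  assumes "insertable n T (x # w)"
  shows "insertable n (row_insert T x) w" "insertable n (col_insert T x) w"
  using ptab_row_insert[of n T x] ptab_col_insert[of n T x] assms
  by (auto simp: insertable_def)

lemma row_insert_foldl_col:
  assumes "insertable n T (y # u)"
  shows "row_insert (foldl col_insert T u) y = foldl col_insert (row_insert T y) u"
  using assms
proof (induction u arbitrary: T)
  case (Cons x u)
  have T: "ptab n T" "1 \<le> x" "x \<le> n" "x \<notin> ran T" "1 \<le> y" "y \<le> n" "y \<notin> ran T" "x \<noteq> y"
    using Cons.prems by (auto simp: insertable_def)
  have "insertable n (col_insert T x) (y # u)"
    using Cons.prems ptab_col_insert[OF T(1-4)] by (auto simp: insertable_def)
  then show ?case using Cons.IH row_col_insert_commute[OF T] by simp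
qed simp

lemma foldl_row_foldl_col:
  assumes "insertable n T (u @ v)"
  shows "foldl row_insert (foldl col_insert T u) v = foldl col_insert (foldl row_insert T v) u"
  using assms
proof (induction v arbitrary: T)
  case (Cons y v)
  have 1: "insertable n T (y # u)" using Cons.prems by (auto simp: insertable_def)
  have y: "ptab n T" "1 \<le> y" "y \<le> n" "y \<notin> ran T" using Cons.prems by (auto simp: insertable_def)
  have "insertable n (row_insert T y) (u @ v)"
    using Cons.prems ptab_row_insert[OF y] by (auto simp: insertable_def)
  then show ?case using Cons.IH row_insert_foldl_col[OF 1] by simp
qed simp

lemma row_insert_empty: "row_insert Map.empty x = [(1, 1) \<mapsto> x]"
  by (simp add: row_insert_def)

lemma col_insert_empty: "col_insert Map.empty x = [(1, 1) \<mapsto> x]"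
  by (simp add: col_insert_def)

text \<open>The row insertion of the last letter can be moved in front of all column insertions, and
  into the empty tableau both insertions of that letter do the same.\<close>

lemma foldl_col_rev:
  assumes "insertable n Map.empty w"
  shows "foldl col_insert Map.empty (rev w) = foldl row_insert Map.empty w"
  using assms
proof (induction w rule: rev_induct)
  case (snoc y w)
  have 1: "insertable n Map.empty w" and 2: "insertable n Map.empty (y # rev w)"
    using snoc.prems by (auto simp: insertable_def)
  have "foldl row_insert Map.empty (w @ [y]) = row_insert (foldl col_insert Map.empty (rev w)) y"
    using snoc.IH[OF 1] by simp
  also have "\<dots> = foldl col_insert (row_insert Map.empty y) (rev w)"
    by (rule row_insert_foldl_col[OF 2])
  finally show ?case by (simp add: row_insert_empty col_insert_empty)
qed simp

text \<open>In each column met, the rows above \<open>i\<close> hold only entries smaller than the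
  incoming value, so only the entry of row \<open>i\<close> can be bumped: row \<open>i\<close>
  slides one place to the right behind \<open>y\<close>. The hypotheses reach column
  \<open>c + length zs\<close> because the last entry moves into that empty box.\<close>

lemma col_ins_aux_push:
  assumes "length zs < f" "1 \<le> i"
    and "\<And>q. q < length zs \<Longrightarrow> S (i, c + q) = Some (zs ! q)" "S (i, c + length zs) = None"
    and "sorted_wrt (<) (y # zs)"
    and "\<And>q. q \<le> length zs \<Longrightarrow> {a. a \<noteq> i \<and> S (a, c + q) \<noteq> None} = {1..<i}"
    and "\<And>q a v. q \<le> length zs \<Longrightarrow> a \<noteq> i \<Longrightarrow> S (a, c + q) = Some v \<Longrightarrow> v < (y # zs) ! q"
    and "\<And>q a a' v. q \<le> length zs \<Longrightarrow> a \<noteq> i \<Longrightarrow> a' \<noteq> i \<Longrightarrow> S (a, c + q) = Some v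
      \<Longrightarrow> S (a', c + q) = Some v \<Longrightarrow> a = a'"
  shows "col_ins_aux f S c y =
    (\<lambda>(a, b). if a = i \<and> c \<le> b \<and> b \<le> c + length zs then Some ((y # zs) ! (b - c)) else S (a, b))"
  using assms
proof (induction zs arbitrary: f S c y)
  case Nil
  obtain f' where f: "f = Suc f'" using Nil.prems(1) by (cases f) auto
  have vals: "{v. \<exists>a. S (a, c) = Some v} = (\<lambda>a. the (S (a, c))) ` {a. a \<noteq> i \<and> S (a, c) \<noteq> None}"
  proof (intro equalityI subsetI)
    fix v
    assume "v \<in> {v. \<exists>a. S (a, c) = Some v}"
    then obtain a where a: "S (a, c) = Some v" by blast
    then have "a \<noteq> i" using Nil.prems(4) by auto
    then show "v \<in> (\<lambda>a. the (S (a, c))) ` {a. a \<noteq> i \<and> S (a, c) \<noteq> None}"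
      using a by (intro image_eqI[of _ _ a]) auto
  qed auto
  have "card {v. \<exists>a. S (a, c) = Some v} = card {a. a \<noteq> i \<and> S (a, c) \<noteq> None}"
    unfolding vals
  proof (rule card_image, rule inj_onI)
    fix a a'
    assume *: "a \<in> {a. a \<noteq> i \<and> S (a, c) \<noteq> None}" "a' \<in> {a. a \<noteq> i \<and> S (a, c) \<noteq> None}"
      "the (S (a, c)) = the (S (a', c))"
    then show "a = a'" using Nil.prems(8)[of 0 a a'] by auto
  qed
  then have card: "Suc (card {v. \<exists>a. S (a, c) = Some v}) = i"
    using Nil.prems(6)[of 0] Nil.prems(2) by simp
  have "v < y" if "S (a, c) = Some v" for a v
    using that Nil.prems(7)[of 0 a v] Nil.prems(4) by (cases "a = i") auto
  then have "col_ins_aux f S c y = S((i, c) \<mapsto> y)"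
    unfolding f using card by (auto simp: Let_def simp del: fun_upd_apply)
  then show ?case by (auto simp: fun_eq_iff)
next
  case (Cons z zs)
  obtain f' where f: "f = Suc f'" using Cons.prems(1) by (cases f) auto
  have yz: "y < z" using Cons.prems(5) by simp
  have zi: "S (i, c) = Some z" using Cons.prems(3)[of 0] by simp
  have other: "v < y" if "S (a, c) = Some v" "a \<noteq> i" for a v
    using that Cons.prems(7)[of 0 a v] by simp
  have "{v. (\<exists>a. S (a, c) = Some v) \<and> y < v} = {z}"
  proof (intro equalityI subsetI)
    fix v
    assume "v \<in> {v. (\<exists>a. S (a, c) = Some v) \<and> y < v}"
    then obtain a where a: "S (a, c) = Some v" "y < v" by blast
    then have "a = i" using other[OF a(1)] by (metis less_asym)
    then show "v \<in> {z}" using a zi by simp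
  qed (use zi yz in auto)
  then have mn: "Min {v \<in> {v. \<exists>a. S (a, c) = Some v}. y < v} = z" by simp
  have "(THE a. S (a, c) = Some z) = i"
    using zi other yz by (metis (mono_tags, lifting) less_asym the_equality)
  moreover have "\<not> (\<forall>v\<in>{v. \<exists>a. S (a, c) = Some v}. v < y)" 
  proof
    assume "\<forall>v\<in>{v. \<exists>a. S (a, c) = Some v}. v < y"
    then have "z < y" using zi by blast
    then show False using yz by simp
  qed
  ultimately have "col_ins_aux f S c y = col_ins_aux f' (S((i, c) \<mapsto> y)) (Suc c) z"
    unfolding f col_ins_aux.simps Let_def mn by (simp only: if_False)
  also have "\<dots> = (\<lambda>(a, b). if a = i \<and> Suc c \<le> b \<and> b \<le> Suc c + length zs
      then Some ((z # zs) ! (b - Suc c)) else (S((i, c) \<mapsto> y)) (a, b))"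
  proof (rule Cons.IH)
    show "length zs < f'" using Cons.prems(1) f by simp
    show "(S((i, c) \<mapsto> y)) (i, Suc c + q) = Some (zs ! q)" if "q < length zs" for q
      using Cons.prems(3)[of "Suc q"] that by simp
    show "(S((i, c) \<mapsto> y)) (i, Suc c + length zs) = None" using Cons.prems(4) by simp
    show "sorted_wrt (<) (z # zs)" using Cons.prems(5) by simp
    show "{a. a \<noteq> i \<and> (S((i, c) \<mapsto> y)) (a, Suc c + q) \<noteq> None} = {1..<i}" if "q \<le> length zs" for q
      using Cons.prems(6)[of "Suc q"] that by simp
    show "v < (z # zs) ! q"
      if "q \<le> length zs" "a \<noteq> i" "(S((i, c) \<mapsto> y)) (a, Suc c + q) = Some v" for q a v
      using Cons.prems(7)[of "Suc q" a v] that by simp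
    show "a = a'" if "q \<le> length zs" "a \<noteq> i" "a' \<noteq> i" "(S((i, c) \<mapsto> y)) (a, Suc c + q) = Some v"
      "(S((i, c) \<mapsto> y)) (a', Suc c + q) = Some v" for q a a' v
      using Cons.prems(8)[of "Suc q" a a' v] that by simp
  qed (rule Cons.prems(2))
  also have "\<dots> = (\<lambda>(a, b). if a = i \<and> c \<le> b \<and> b \<le> c + length (z # zs)
      then Some ((y # z # zs) ! (b - c)) else S (a, b))"
  proof (rule ext)
    fix d :: cell
    obtain a b where d: "d = (a, b)" by force
    consider "a \<noteq> i \<or> b < c" | "a = i" "b = c" | k where "a = i" "b = Suc (c + k)"
      by (metis less_iff_Suc_add linorder_neqE_nat)
    then show "(case d of (a, b) \<Rightarrow> if a = i \<and> Suc c \<le> b \<and> b \<le> Suc c + length zs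
        then Some ((z # zs) ! (b - Suc c)) else (S((i, c) \<mapsto> y)) (a, b))
      = (case d of (a, b) \<Rightarrow> if a = i \<and> c \<le> b \<and> b \<le> c + length (z # zs)
        then Some ((y # z # zs) ! (b - c)) else S (a, b))"
      unfolding d by cases (auto simp: Suc_diff_le)
  qed
  finally show ?case .
qed

text \<open>Read from right to left, a row decreases, so each letter settles in the first box of row
  \<open>i\<close> and pushes the part already present to the right, leaving the rows above
  untouched.\<close>

lemma foldl_col_insert_row:
  assumes g: "growth e n" and i: "1 \<le> i"
  defines "T \<equiv> tab_of_seq e n"
  defines "w \<equiv> map (\<lambda>j. the (T (i, j))) [1..<Suc (rowlen (e n) i)]"
  shows "foldl col_insert (\<lambda>(a, b). if a < i then T (a, b) else None) (rev w)
    = (\<lambda>(a, b). if a \<le> i then T (a, b) else None)"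
proof -
  let ?l = "rowlen (e n) i"
  \<comment> \<open>The state after a suffix \<open>zs\<close> of row \<open>i\<close> has been
    inserted: it is left-justified in row \<open>i\<close>, not yet at its final place.\<close>
  define S where "S zs = (\<lambda>(a, b). if a < i then T (a, b)
    else if a = i \<and> 1 \<le> b \<and> b \<le> length zs then Some (zs ! (b - 1)) else None)" for zs
  have D: "is_partition (e n)" using growth_partition[OF g] by simp
  have dT: "dom T = e n" unfolding T_def by (rule dom_tab_of_seq[OF g])
  have memi: "(i, b) \<in> e n \<longleftrightarrow> 1 \<le> b \<and> b \<le> ?l" for b by (rule partition_mem_iff[OF D])
  have lw: "length w = ?l" by (simp add: w_def)
  have nthw: "T (i, Suc q) = Some (w ! q)" if "q < ?l" for q
  proof -
    have "(i, Suc q) \<in> dom T" using memi[of "Suc q"] that dT by simp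
    then show ?thesis using that by (auto simp: w_def nth_append simp del: upt_Suc)
  qed
  note less = tab_of_seq_less[OF g, folded T_def]
  have sorted: "sorted_wrt (<) w"
    unfolding sorted_wrt_iff_nth_less lw using less[OF nthw nthw] by simp
  have "foldl col_insert (S []) (rev (drop d w)) = S (drop d w)" for d
  proof (induction "length w - d" arbitrary: d)
    case 0
    then show ?case by simp
  next
    case (Suc m)
    then have d: "d < length w" by simp
    let ?zs = "drop (Suc d) w" and ?y = "w ! d"
    have dr: "drop d w = ?y # ?zs" using d by (rule Cons_nth_drop_Suc[symmetric])
    have IH: "foldl col_insert (S []) (rev ?zs) = S ?zs" using Suc by simp
    have nthz: "(?y # ?zs) ! q = w ! (d + q)" if "q \<le> length ?zs" for q
      using dr[symmetric] that d by simp
    have Srow: "S ?zs (a, Suc q) = T (a, Suc q)" if "a < i" for a q using that by (simp add: S_def)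
    have Sgt: "S ?zs (a, b) = None" if "i < a" for a b using that by (simp add: S_def)
    have col: "col_insert (S ?zs) ?y = (\<lambda>(a, b). if a = i \<and> 1 \<le> b \<and> b \<le> 1 + length ?zs
        then Some ((?y # ?zs) ! (b - 1)) else S ?zs (a, b))"
      unfolding col_insert_def
    proof (rule col_ins_aux_push)
      \<comment> \<open>The fuel has to cover one bump for each entry of the suffix already in row
        \<open>i\<close>; these entries are themselves part of the domain.\<close>
      have "dom (S ?zs) \<subseteq> dom T \<union> {i} \<times> {1..length ?zs}"
        by (auto simp: S_def split: if_splits)
      moreover have "finite (dom T)" using dT partition_finite[OF D] by simp
      ultimately have "finite (dom (S ?zs))" by (meson finite_SigmaI finite_UnI finite_atLeastAtMost finite.emptyI finite_insert finite_subset)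
      moreover have "{i} \<times> {1..length ?zs} \<subseteq> dom (S ?zs)" by (auto simp: S_def)
      ultimately have "card ({i} \<times> {1..length ?zs}) \<le> card (dom (S ?zs))" by (rule card_mono)
      then show "length ?zs < Suc (card (dom (S ?zs)))" by (simp add: card_cartesian_product)
      show "S ?zs (i, 1 + q) = Some (?zs ! q)" if "q < length ?zs" for q
        using that by (simp add: S_def)
      show "S ?zs (i, 1 + length ?zs) = None" by (simp add: S_def)
      show "sorted_wrt (<) (?y # ?zs)" unfolding dr[symmetric] using sorted by (rule sorted_wrt_drop)
      show "{a. a \<noteq> i \<and> S ?zs (a, 1 + q) \<noteq> None} = {1..<i}" if q: "q \<le> length ?zs" for q
      proof -
        \<comment> \<open>Row \<open>i\<close> of the complete shape reaches column
          \<open>Suc q\<close>, hence so do all rows above it.\<close>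
        have "(i, Suc q) \<in> e n" using memi[of "Suc q"] q d lw by simp
        then have 1: "(a, Suc q) \<in> dom T" if "1 \<le> a" "a < i" for a
          using partition_down[OF D, of i "Suc q" a "Suc q"] that dT by simp
        have 2: "1 \<le> a" if "T (a, Suc q) = Some v" for a v
          using partition_pos(1)[OF D, of a "Suc q"] that dT by blast
        show ?thesis
        proof (intro equalityI subsetI)
          fix a
          assume "a \<in> {a. a \<noteq> i \<and> S ?zs (a, 1 + q) \<noteq> None}"
          then have "a < i" "T (a, Suc q) \<noteq> None"
            using Sgt[of a] Srow[of a q] by (auto simp: not_less_iff_gr_or_eq) (metis linorder_neqE_nat option.distinct(1))+
          then show "a \<in> {1..<i}" using 2 by auto
        next
          fix a
          assume "a \<in> {1..<i}"
          then show "a \<in> {a. a \<noteq> i \<and> S ?zs (a, 1 + q) \<noteq> None}"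
            using 1[of a] Srow[of a q] by auto
        qed
      qed
      show "v < (?y # ?zs) ! q" if "q \<le> length ?zs" "a \<noteq> i" "S ?zs (a, 1 + q) = Some v" for q a v
      proof -
        have ai: "a < i" using that Sgt[of a] by (metis linorder_neqE_nat option.distinct(1))
        then have "T (a, Suc q) = Some v" using that Srow by simp
        \<comment> \<open>The letter arriving in column \<open>Suc q\<close> ends up
          \<open>d\<close> columns further right, so it exceeds the entries above by monotonicity in
          both directions.\<close>
        moreover have "T (i, Suc (d + q)) = Some (w ! (d + q))" by (rule nthw) (use that d lw in simp)
        ultimately have "v < w ! (d + q)" by (rule less) (use ai in auto)
        then show ?thesis using nthz that by simp
      qed
      show "a = a'" if "q \<le> length ?zs" "a \<noteq> i" "a' \<noteq> i" "S ?zs (a, 1 + q) = Some v"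
        "S ?zs (a', 1 + q) = Some v" for q a a' v
      proof -
        have "a < i" "a' < i" using that Sgt by (metis linorder_neqE_nat option.distinct(1))+
        then have "T (a, Suc q) = Some v" "T (a', Suc q) = Some v" using that Srow by auto
        then show ?thesis using inj_tabD[OF inj_tab_of_seq[OF g, folded T_def]] by blast
      qed
    qed (rule i)
    also have "\<dots> = S (?y # ?zs)"
      by (auto simp: S_def fun_eq_iff)
    finally show ?case unfolding dr using IH by simp
  qed
  from this[of 0] have "foldl col_insert (S []) (rev w) = S w" by simp
  moreover have "S [] = (\<lambda>(a, b). if a < i then T (a, b) else None)" by (auto simp: S_def fun_eq_iff)
  moreover have "S w = (\<lambda>(a, b). if a \<le> i then T (a, b) else None)"
  proof (rule ext)
    fix c :: cell
    obtain a b where c: "c = (a, b)" by force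
    have "T (i, b) = (if 1 \<le> b \<and> b \<le> ?l then Some (w ! (b - 1)) else None)"
    proof (cases "1 \<le> b \<and> b \<le> ?l")
      case True
      then show ?thesis using nthw[of "b - 1"] by auto
    next
      case False
      then show ?thesis using memi[of b] dT by (metis domIff)
    qed
    then show "S w c = (case c of (a, b) \<Rightarrow> if a \<le> i then T (a, b) else None)"
      unfolding c S_def using lw by auto
  qed
  ultimately show ?thesis by simp
qed

lemma foldl_col_insert_rev_reading_word:
  assumes "ptab n T"
  shows "foldl col_insert Map.empty (rev_reading_word T) = T"
proof -
  obtain e where g: "growth e n" and T: "T = tab_of_seq e n" using assms by (auto simp: ptab_def)
  have D: "is_partition (e n)" using growth_partition[OF g] by simp
  have dT: "dom T = e n" unfolding T by (rule dom_tab_of_seq[OF g])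
  let ?row = "\<lambda>i. rev (map (\<lambda>j. the (T (i, j))) [1..<Suc (rowlen (e n) i)])"
  have rw: "foldl col_insert Map.empty (concat (map ?row [1..<Suc k]))
    = (\<lambda>(a, b). if a \<le> k then T (a, b) else None)" for k
  proof (induction k)
    case 0
    have "T (0, b) = None" for b using partition_pos(1)[OF D, of 0 b] dT by (auto simp: domIff)
    then show ?case by (auto simp: fun_eq_iff)
  next
    case (Suc k)
    have "foldl col_insert (\<lambda>(a, b). if a < Suc k then T (a, b) else None) (?row (Suc k))
      = (\<lambda>(a, b). if a \<le> Suc k then T (a, b) else None)"
      unfolding T by (rule foldl_col_insert_row[OF g]) simp
    then show ?case using Suc by (simp add: less_Suc_eq_le)
  qed
  have "{i. (i, 1) \<in> e n} = {1..tab_nrows T}"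
    using partition_row[of "conj (e n)" 1] D dT by (simp add: tab_nrows_def rowlen_def)
  then have rows: "(i, 1) \<in> e n \<Longrightarrow> i \<le> tab_nrows T" for i by auto
  have "T (a, b) = None" if "\<not> a \<le> tab_nrows T" for a b
  proof (rule ccontr)
    assume "T (a, b) \<noteq> None"
    then have ab: "(a, b) \<in> e n" using dT by auto
    then have "(a, 1) \<in> e n" using partition_down[OF D ab, of a 1] partition_pos[OF D ab] by simp
    then show False using rows that by blast
  qed
  then have "(\<lambda>(a, b). if a \<le> tab_nrows T then T (a, b) else None) = T" by (auto simp: fun_eq_iff)
  moreover have "rev_reading_word T = concat (map ?row [1..<Suc (tab_nrows T)])"
    unfolding rev_reading_word_def tab_rowlen_def dT rowlen_def ..
  ultimately show ?thesis using rw[of "tab_nrows T"] by simp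
qed

lemma rev_reading_word_entries:
  assumes "ptab n T"
  shows "distinct (rev_reading_word T)" "set (rev_reading_word T) \<subseteq> ran T"
proof -
  obtain e where g: "growth e n" and T: "T = tab_of_seq e n" using assms by (auto simp: ptab_def)
  have D: "is_partition (e n)" using growth_partition[OF g] by simp
  have dT: "dom T = e n" unfolding T by (rule dom_tab_of_seq[OF g])
  have inj: "inj_tab T" unfolding T by (rule inj_tab_of_seq[OF g])
  let ?row = "\<lambda>i. rev (map (\<lambda>j. the (T (i, j))) [1..<Suc (rowlen (e n) i)])"
  have val: "T (i, j) = Some (the (T (i, j)))" if "j \<in> set [1..<Suc (rowlen (e n) i)]" for i j
  proof -
    have "(i, j) \<in> dom T" using that partition_mem_iff[OF D, of i j] dT by auto
    then show ?thesis by auto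
  qed
  have row: "distinct (?row i)" for i
  proof -
    have "inj_on (\<lambda>j. the (T (i, j))) (set [1..<Suc (rowlen (e n) i)])"
    proof (rule inj_onI)
      fix x y
      assume *: "x \<in> set [1..<Suc (rowlen (e n) i)]" "y \<in> set [1..<Suc (rowlen (e n) i)]"
        "the (T (i, x)) = the (T (i, y))"
      have "T (i, y) = Some (the (T (i, x)))" using val[OF *(2)] *(3) by simp
      from inj_tabD[OF inj val[OF *(1)] this] show "x = y" by simp
    qed
    then show ?thesis unfolding distinct_rev distinct_map by simp
  qed
  have rowset: "\<exists>j. T (i, j) = Some v" if "v \<in> set (?row i)" for i v
    using that val[of _ i] unfolding set_rev set_map by fast
  have "distinct (concat (map ?row [1..<Suc k]))
    \<and> (\<forall>v\<in>set (concat (map ?row [1..<Suc k])). \<exists>a b. a \<le> k \<and> T (a, b) = Some v)" for k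
  proof (induction k)
    case (Suc k)
    have "set (concat (map ?row [1..<Suc k])) \<inter> set (?row (Suc k)) = {}"
    proof (rule ccontr)
      assume "\<not> ?thesis"
      then obtain v where v: "v \<in> set (concat (map ?row [1..<Suc k]))" "v \<in> set (?row (Suc k))" by blast
      obtain a b where ab: "a \<le> k" "T (a, b) = Some v" using Suc v(1) by blast
      obtain j where "T (Suc k, j) = Some v" using rowset[OF v(2)] by blast
      then show False using inj_tabD[OF inj ab(2)] ab(1) by fastforce
    qed
    moreover have "\<exists>a b. a \<le> Suc k \<and> T (a, b) = Some v" if "v \<in> set (?row (Suc k))" for v
      using rowset[OF that] by blast
    moreover have "concat (map ?row [1..<Suc (Suc k)]) = concat (map ?row [1..<Suc k]) @ ?row (Suc k)"
      by simp
    moreover have "\<exists>a b. a \<le> Suc k \<and> T (a, b) = Some v"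
      if "v \<in> set (concat (map ?row [1..<Suc k]))" for v
      using Suc that le_SucI by blast
    moreover have "distinct (concat (map ?row [1..<Suc k]))" using Suc by blast
    ultimately show ?case using row[of "Suc k"]
      by (simp only: distinct_append set_append simp_thms Ball_def) blast
  qed simp
  note this[of "tab_nrows T"]
  moreover have "rev_reading_word T = concat (map ?row [1..<Suc (tab_nrows T)])"
    unfolding rev_reading_word_def tab_rowlen_def dT rowlen_def ..
  ultimately have "distinct (rev_reading_word T)"
    "\<forall>v\<in>set (rev_reading_word T). \<exists>a b. a \<le> tab_nrows T \<and> T (a, b) = Some v"
    by argo+
  then show "distinct (rev_reading_word T)" "set (rev_reading_word T) \<subseteq> ran T"
    by (auto intro: ranI)
qed

text \<open>Write \<open>T\<close> as a row insertion tableau; then column insertion of \<open>u\<close> into \<open>T\<close> is row insertion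
  into the column insertion tableau of \<open>u\<close>, and so depends only on the latter.\<close>

lemma foldl_col_insert_reading_word:
  assumes T: "ptab n T" and w: "insertable n T w"
  shows "foldl col_insert T (rev_reading_word (foldl row_insert Map.empty w))
    = foldl col_insert T (rev w)"
proof -
  have w0: "insertable n Map.empty w" using w ptab_empty by (simp add: insertable_def)
  have "ptab n (foldl row_insert U w) \<and> ran (foldl row_insert U w) = ran U \<union> set w"
    if "insertable n U w" for U
    using that
  proof (induction w arbitrary: U)
    case (Cons x w)
    have "ran (row_insert U x) = insert x (ran U)"
      by (rule ptab_row_insert(2)) (use Cons.prems in \<open>auto simp: insertable_def\<close>)
    then show ?case using Cons.IH[OF insertable_Cons(1)[OF Cons.prems]] by simp
  qed (simp add: insertable_def)
  note this[OF w0]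
  then have I: "ptab n (foldl row_insert Map.empty w)" "ran (foldl row_insert Map.empty w) = set w"
    by auto
  let ?I = "foldl row_insert Map.empty w"
  let ?u = "rev_reading_word ?I"
  let ?v = "rev_reading_word (tr T)"
  note tT = ptab_tr[OF T]
  have "tr (foldl col_insert U v) = foldl row_insert (tr U) v" for U v
    by (induction v arbitrary: U) (simp_all, metis col_insert_tr tr_tr)
  \<comment> \<open>Column insertion of its own reading word rebuilds \<open>tr T\<close>;
    transposing exhibits \<open>T\<close> as the row insertion tableau of that same word.\<close>
  from this[of Map.empty ?v] have v: "T = foldl row_insert Map.empty ?v"
    using foldl_col_insert_rev_reading_word[OF tT] by simp
  have ran_T: "ran T \<subseteq> {1..n}" using T ran_tab_of_seq by (auto simp: ptab_def)
  have 1: "foldl col_insert T x = foldl row_insert (foldl col_insert Map.empty x) ?v"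
    if "distinct x" "set x \<subseteq> set w" for x
  proof -
    have "insertable n Map.empty (x @ ?v)"
      using that rev_reading_word_entries[OF tT] w ran_T ptab_empty by (auto simp: insertable_def)
    from foldl_row_foldl_col[OF this] v show ?thesis by simp
  qed
  have "foldl col_insert Map.empty ?u = foldl col_insert Map.empty (rev w)"
    using foldl_col_insert_rev_reading_word[OF I(1)] foldl_col_rev[OF w0] by simp
  then show ?thesis
    using 1[of ?u] 1[of "rev w"] rev_reading_word_entries[OF I(1)] I(2) w
    by (simp add: insertable_def)
qed

section \<open>Roby's growth diagram\<close>

declare back_lab.simps [simp del] rob_lab.simps [simp del] rob_ilab.simps [simp del]

section \<open>Backward rules as inverses of the forward rules\<close>

lemma partition_Int:
  assumes "is_partition D" "is_partition E"
  shows "is_partition (D \<inter> E)"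
  using assms unfolding is_partition_def by auto

lemma partition_remove:
  assumes D: "is_partition D" and corner: "(Suc p, q) \<notin> D" "(p, Suc q) \<notin> D"
  shows "is_partition (D - {(p, q)})"
proof -
  have "(i', j') \<in> D - {(p, q)}"
    if "(i, j) \<in> D - {(p, q)}" "1 \<le> i'" "i' \<le> i" "1 \<le> j'" "j' \<le> j" for i j i' j'
  proof -
    have ij: "(i, j) \<in> D" "(i, j) \<noteq> (p, q)" using that(1) by auto
    have "(i', j') \<in> D" using partition_down[OF D ij(1)] that by blast
    moreover have "(i', j') \<noteq> (p, q)"
    proof
      assume "(i', j') = (p, q)"
      then have "p < i \<or> q < j" "p \<le> i" "q \<le> j" "1 \<le> p" "1 \<le> q" using that ij(2) by auto
      then show False
        using corner partition_down[OF D ij(1), of "Suc p" q] partition_down[OF D ij(1), of p "Suc q"]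
        by auto
    qed
    ultimately show ?thesis by blast
  qed
  moreover have "1 \<le> i \<and> 1 \<le> j" if "(i, j) \<in> D - {(p, q)}" for i j
    using that partition_pos[OF D, of i j] by blast
  ultimately show ?thesis
    using partition_finite[OF D] unfolding is_partition_def by blast
qed

text \<open>The triangle is computed downwards but insertion runs upwards. Given that the top and
  right sides grow, a backward step yields a cell obeying the forward rules, with a cross only when
  its left and bottom sides are trivial.\<close>

lemma back_rule_fwd_rule:
  assumes EP: "grow E P" and FP: "grow F P" and b: "back_rule P E F = (D, c)"
  shows "grow D E" "grow D F" "P = fwd_rule D E F c" "c \<Longrightarrow> E = D \<and> F = D"
proof -
  have E: "is_partition E" and F: "is_partition F" and P: "is_partition P"
    using EP FP by (auto simp: grow_def)
  have "grow D E \<and> grow D F \<and> P = fwd_rule D E F c \<and> (c \<longrightarrow> E = D \<and> F = D)"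
  proof (cases "E = F")
    case False
    then have D: "D = E \<inter> F" and c: "\<not> c" using b by (auto simp: back_rule_def)
    have pD: "is_partition D" unfolding D by (rule partition_Int[OF E F])
    have "P = E \<or> (\<exists>x. x \<notin> E \<and> P = insert x E)" "P = F \<or> (\<exists>x. x \<notin> F \<and> P = insert x F)"
      using EP FP by (auto simp: grow_def)
    then consider "P = E" "P = F" | x where "P = E" "x \<notin> F" "P = insert x F"
      | x where "P = F" "x \<notin> E" "P = insert x E"
      | x y where "x \<notin> E" "P = insert x E" "y \<notin> F" "P = insert y F" by blast
    then show ?thesis
    proof cases
      case 1
      then show ?thesis using False by simp
    next
      case 2
      then have "D = F" using D by auto
      moreover have "grow F E" using 2 FP by simp
      ultimately show ?thesis using fwd_rule_same c 2 F by (simp add: grow_refl)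
    next
      case 3
      then have "D = E" using D by auto
      moreover have "grow E F" using 3 EP by simp
      ultimately show ?thesis using fwd_rule_stay c 3 E by (simp add: grow_refl)
    next
      case (4 x y)
      then have "x \<noteq> y" using False by (metis insert_ident)
      then have "E = insert y D" "F = insert x D" "x \<notin> D" "y \<notin> D" using 4 D by auto
      then have "grow D E" "grow D F" "P = insert y (insert x D)"
        using pD E F 4 unfolding grow_def by auto
      then show ?thesis
        using fwd_rule_diff[of y D x] \<open>E = insert y D\<close> \<open>F = insert x D\<close> \<open>x \<notin> D\<close> \<open>y \<notin> D\<close> \<open>x \<noteq> y\<close> c
        by simp
    qed
  next
    case EF: True
    show ?thesis using EP
    proof (cases rule: grow_cases)
      case 1
      then have "D = E" "\<not> c" using b EF by (auto simp: back_rule_def)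
      then show ?thesis using 1 EF fwd_rule_same[OF grow_refl[OF E]] by (simp add: grow_refl)
    next
      case (2 a)
      obtain i j where a: "a = (i, j)" by force
      have aE: "a \<notin> E" using 2 by (simp add: addable_def)
      then have "P \<noteq> E" using 2 by auto
      have br: "box_row P E = i" using box_row_insert[OF aE] 2(2) a by simp
      show ?thesis
      proof (cases "i = 1")
        case True
        then have "D = E" "c" using b EF br \<open>P \<noteq> E\<close> by (auto simp: back_rule_def)
        then show ?thesis
          using EF E 2(2) add_box_addable[OF 2(1)] a True by (simp add: grow_refl fwd_rule_def)
      next
        case False
        let ?s = "(i - 1, rowlen E (i - 1))"
        have D: "D = E - {?s}" and c: "\<not> c"
          using b EF br \<open>P \<noteq> E\<close> False by (auto simp: back_rule_def remove_box_def)
        have ij: "(i, j) \<notin> E" "1 \<le> i" "(i - 1, j) \<in> E" "1 \<le> j"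
          using 2(1) False unfolding a addable_iff[OF E] by auto
        have j: "1 \<le> j" "j \<le> rowlen E (i - 1)" using ij(3) partition_mem_iff[OF E] by auto
        have sE: "?s \<in> E" using j partition_mem_iff[OF E] by simp
        \<comment> \<open>Box \<open>a\<close> is free in row \<open>i\<close> although row
          \<open>i - 1\<close> reaches its column, so row \<open>i\<close> is strictly shorter and
          the last box of row \<open>i - 1\<close> is a removable corner.\<close>
        have "(i, rowlen E (i - 1)) \<notin> E"
        proof
          assume "(i, rowlen E (i - 1)) \<in> E"
          from partition_down[OF E this, of i j] show False using ij j by simp
        qed
        moreover have "(i - 1, Suc (rowlen E (i - 1))) \<notin> E" using partition_mem_iff[OF E] by simp
        ultimately have pD: "is_partition D"
          unfolding D using ij(2) by (intro partition_remove[OF E]) auto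
        have Es: "E = insert ?s D" using D sE by auto
        have s: "addable D ?s" using pD E Es D unfolding addable_def by auto
        have "addable (insert ?s D) a" using 2(1) Es by simp
        then have "fwd_rule D E E False = insert a E"
          using fwd_rule_bump_eq[OF s, of a] Es a ij(2) by simp
        then show ?thesis using EF 2(2) c growI_addable[OF s] Es by simp
      qed
    qed
  qed
  then show "grow D E" "grow D F" "P = fwd_rule D E F c" "c \<Longrightarrow> E = D \<and> F = D" by auto
qed

text \<open>At a cross the two borders of the strip still agree, but from the first cross on they
  differ for good. Hence a strip has at most one cross and is either a copy or an insertion.\<close>

lemma row_growth:
  assumes e: "growth e n" and f0: "f 0 = {}"
    and step: "\<And>j. j < n \<Longrightarrow> f (Suc j) = fwd_rule (e j) (f j) (e (Suc j)) (X (Suc j))"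
    and cross: "\<And>j. j < n \<Longrightarrow> X (Suc j) \<Longrightarrow> f j = e j \<and> e (Suc j) = e j"
  obtains "\<And>j. 1 \<le> j \<Longrightarrow> j \<le> n \<Longrightarrow> \<not> X j" "\<And>k. k \<le> n \<Longrightarrow> f k = e k"
  | x where "fresh e n x" "\<And>j. 1 \<le> j \<Longrightarrow> j \<le> n \<Longrightarrow> X j \<longleftrightarrow> j = x" "\<And>k. k \<le> n \<Longrightarrow> f k = rins e x k"
proof -
  have *: "m \<le> n \<Longrightarrow> grow (e m) (f m) \<and> (f m = e m \<longleftrightarrow> (\<forall>j. 1 \<le> j \<and> j \<le> m \<longrightarrow> \<not> X j))" for m
  proof (induction m)
    case 0
    then show ?case using e f0 by (simp add: growth_def grow_refl)
  next
    case (Suc m)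
    then have IH: "grow (e m) (f m)" "f m = e m \<longleftrightarrow> (\<forall>j. 1 \<le> j \<and> j \<le> m \<longrightarrow> \<not> X j)" by auto
    show ?case
      using fwd_rule_grow(2,3)[OF IH(1) growth_step[OF e, of m], of "X (Suc m)"] cross[of m] step[of m]
        IH(2) Suc.prems
      by (auto simp: le_Suc_eq)
  qed
  show thesis
  proof (cases "\<exists>x. 1 \<le> x \<and> x \<le> n \<and> X x")
    case False
    then show thesis using that(1) * by (meson order_trans)
  next
    case True
    then obtain x where x: "1 \<le> x" "x \<le> n" "X x" by blast
    have before: "f (j - 1) = e (j - 1) \<and> e j = e (j - 1)" if "1 \<le> j" "j \<le> n" "X j" for j
      using cross[of "j - 1"] that by simp
    have unique: "\<not> j < k" if "1 \<le> j" "k \<le> n" "X j" "X k" for j k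
    proof
      assume "j < k"
      then have "f (k - 1) = e (k - 1)" "k - 1 \<le> n" "j \<le> k - 1" using before[of k] that by auto
      then show False using *[of "k - 1"] that by blast
    qed
    have iff: "X j \<longleftrightarrow> j = x" if "1 \<le> j" "j \<le> n" for j
      using unique[of j x] unique[of x j] x that by (metis linorder_neqE_nat)
    have "fresh e n x" using before[OF x] x by (simp add: fresh_def)
    moreover have "f k = rins e x k" if "k \<le> n" for k
      using that
    proof (induction k)
      case (Suc k)
      then show ?case using step[of k] iff[of "Suc k"] by simp
    qed (simp add: f0)
    ultimately show thesis using that(2) iff by blast
  qed
qed

context
  fixes mus :: "cell set list" and r :: nat
  assumes osc: "osc_tableau mus r"
begin

lemma mus_0: "mus ! 0 = {}"
  using osc by (simp add: osc_tableau_def)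

lemma mus_partition: "k \<le> r \<Longrightarrow> is_partition (mus ! k)"
  using osc by (simp add: osc_tableau_def)

lemma mus_step:
  assumes "k < r"
  obtains b where "b \<notin> mus ! k" "mus ! Suc k = insert b (mus ! k)"
  | b where "b \<notin> mus ! Suc k" "mus ! k = insert b (mus ! Suc k)"
proof -
  have "\<forall>k\<in>{1..r}. card ((mus ! k - mus ! (k - 1)) \<union> (mus ! (k - 1) - mus ! k)) = 1"
    using osc unfolding osc_tableau_def by blast
  from bspec[OF this, of "Suc k"] have "card ((mus ! Suc k - mus ! k) \<union> (mus ! k - mus ! Suc k)) = 1"
    using assms by simp
  then obtain b where "(mus ! Suc k - mus ! k) \<union> (mus ! k - mus ! Suc k) = {b}"
    using card_1_singletonE by blast
  then have "c \<in> (mus ! Suc k - mus ! k) \<union> (mus ! k - mus ! Suc k) \<longleftrightarrow> c = b" for c by simp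
  then have *: "(c \<in> mus ! Suc k \<longleftrightarrow> c \<in> mus ! k) \<longleftrightarrow> c \<noteq> b" for c by blast
  show thesis
  proof (cases "b \<in> mus ! k")
    case True
    have "mus ! k = insert b (mus ! Suc k)" by (rule set_eqI) (use * True in auto)
    then show thesis using that(2) * True by blast
  next
    case False
    have "mus ! Suc k = insert b (mus ! k)" by (rule set_eqI) (use * False in auto)
    then show thesis using that(1) False by blast
  qed
qed

lemma mus_neq: "k < r \<Longrightarrow> mus ! Suc k \<noteq> mus ! k"
  by (rule mus_step[of k]) auto

lemma mus_grow_Int:
  assumes "k < r"
  shows "grow (mus ! k \<inter> mus ! Suc k) (mus ! k)" "grow (mus ! k \<inter> mus ! Suc k) (mus ! Suc k)"
proof -
  have p: "is_partition (mus ! k)" "is_partition (mus ! Suc k)" using mus_partition assms by auto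
  from assms show "grow (mus ! k \<inter> mus ! Suc k) (mus ! k)" "grow (mus ! k \<inter> mus ! Suc k) (mus ! Suc k)"
    by (rule mus_step; use p in \<open>auto simp: grow_def Int_absorb1 Int_absorb2 subset_insertI\<close>)+
qed

section \<open>Labels and crosses below the antidiagonal\<close>

abbreviation (input) L :: "nat \<Rightarrow> nat \<Rightarrow> cell set" where
  "L \<equiv> back_lab mus r"

lemma L_diag: "r \<le> x + y \<Longrightarrow> L x y = conj (mus ! x)"
  by (subst back_lab.simps) simp

lemma L_step: "x + y < r \<Longrightarrow> L x y = fst (back_rule (L (Suc x) (Suc y)) (L x (Suc y)) (L (Suc x) y))"
  by (subst back_lab.simps) simp

lemma L_subdiag:
  assumes "Suc (x + y) = r"
  shows "L x y = conj (mus ! x \<inter> mus ! Suc x)"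
proof -
  have "L x (Suc y) = conj (mus ! x)" "L (Suc x) y = conj (mus ! Suc x)"
    by (rule L_diag, use assms in simp)+
  then show ?thesis using L_step[of x y] mus_neq[of x] assms
    by (auto simp: back_rule_def conj_Int)
qed

lemma L_grow: "x + y < r \<Longrightarrow> grow (L x y) (L (Suc x) y) \<and> grow (L x y) (L x (Suc y))"
proof (induction "r - (x + y)" arbitrary: x y rule: less_induct)
  case less
  show ?case
  proof (cases "Suc (x + y) = r")
    case True
    then show ?thesis using L_subdiag[OF True] mus_grow_Int[of x] by (simp add: L_diag)
  next
    case False
    have 1: "grow (L x (Suc y)) (L (Suc x) (Suc y))" and 2: "grow (L (Suc x) y) (L (Suc x) (Suc y))"
      using less(1)[of x "Suc y"] less(1)[of "Suc x" y] less.prems False by auto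
    obtain D c where b: "back_rule (L (Suc x) (Suc y)) (L x (Suc y)) (L (Suc x) y) = (D, c)" by force
    then have "L x y = D" using L_step less.prems by simp
    then show ?thesis using back_rule_fwd_rule(1,2)[OF 1 2 b] by simp
  qed
qed

lemma L_cell:
  assumes "Suc (Suc (x + y)) \<le> r"
  shows "L (Suc x) (Suc y) = fwd_rule (L x y) (L x (Suc y)) (L (Suc x) y) (back_cross mus r (Suc x) (Suc y))"
    "back_cross mus r (Suc x) (Suc y) \<Longrightarrow> L x (Suc y) = L x y \<and> L (Suc x) y = L x y"
proof -
  have 1: "grow (L x (Suc y)) (L (Suc x) (Suc y))" and 2: "grow (L (Suc x) y) (L (Suc x) (Suc y))"
    using L_grow[of x "Suc y"] L_grow[of "Suc x" y] assms by auto
  obtain D c where b: "back_rule (L (Suc x) (Suc y)) (L x (Suc y)) (L (Suc x) y) = (D, c)" by force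
  have D: "L x y = D" using L_step[of x y] b assms by simp
  have c: "back_cross mus r (Suc x) (Suc y) = c" using b by (simp add: back_cross_def)
  show "L (Suc x) (Suc y) = fwd_rule (L x y) (L x (Suc y)) (L (Suc x) y) (back_cross mus r (Suc x) (Suc y))"
    "back_cross mus r (Suc x) (Suc y) \<Longrightarrow> L x (Suc y) = L x y \<and> L (Suc x) y = L x y"
    unfolding D c using back_rule_fwd_rule(3,4)[OF 1 2 b] by auto
qed

lemma L_left:
  assumes "y \<le> r"
  shows "L 0 y = {}"
  using assms
proof (induction "r - y" arbitrary: y)
  case 0
  then show ?case using L_diag[of 0 y] mus_0 by simp
next
  case (Suc d)
  then have "L 0 (Suc y) = {}" by simp
  moreover have "grow (L 0 y) (L 0 (Suc y))" using L_grow[of 0 y] Suc(2) by simp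
  ultimately show ?case by (auto simp: grow_def)
qed

lemma L_growth: "y \<le> r \<Longrightarrow> growth (\<lambda>x. L x y) (r - y)"
  using L_left[of y] L_grow[of _ y] by (simp add: growth_def)

abbreviation (input) X :: "nat \<Rightarrow> nat \<Rightarrow> bool" where
  "X \<equiv> rob_cross mus r"

lemma X_sym: "X j i \<longleftrightarrow> X i j"
  by (auto simp: rob_cross_def)

lemma X_bounds: "X j i \<Longrightarrow> 1 \<le> i \<and> i \<le> r \<and> 1 \<le> j \<and> j \<le> r"
  by (simp add: rob_cross_def)

lemma X_columns: "{j. \<exists>i. X j i} \<subseteq> {1..r}"
proof
  fix j
  assume "j \<in> {j. \<exists>i. X j i}"
  then obtain i where "X j i" by blast
  from X_bounds[OF this] show "j \<in> {1..r}" by simp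
qed

text \<open>A cell straddling the antidiagonal has consecutive, hence different, shapes at its upper
  left and lower right corners and falls under B1. This is why the involution has no fixed
  points.\<close>

lemma X_irrefl: "\<not> X i i"
proof
  assume X: "X i i"
  then obtain k where k: "i = Suc k" "k < r" using X_bounds[OF X] by (cases i) auto
  have "L k (Suc r - i) = conj (mus ! k)" "L i (Suc r - i - 1) = conj (mus ! i)"
    by (rule L_diag, use k in simp)+
  then show False using X mus_neq[of k] k by (simp add: rob_cross_def back_cross_def back_rule_def split: if_splits)
qed

lemma X_below: "x < r \<Longrightarrow> y < r \<Longrightarrow> Suc (x + y) \<le> r \<Longrightarrow> X (Suc x) (r - y) \<longleftrightarrow> back_cross mus r (Suc x) (Suc y)"
  by (auto simp: rob_cross_def)

text \<open>The strip of matrix row \<open>Suc k\<close>, between heights \<open>r - Suc k\<close>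
  and \<open>r - k\<close>. Only its first \<open>k\<close> cells lie below the antidiagonal; the
  next one straddles it and is empty.\<close>

lemma L_row:
  assumes "k < r"
  obtains "\<And>j. j \<le> Suc k \<Longrightarrow> \<not> X j (Suc k)" "\<And>j. j \<le> k \<Longrightarrow> L j (r - k) = L j (r - Suc k)"
  | x where "fresh (\<lambda>j. L j (r - Suc k)) k x" "\<And>j. j \<le> Suc k \<Longrightarrow> X j (Suc k) \<longleftrightarrow> j = x"
    "\<And>j. j \<le> k \<Longrightarrow> L j (r - k) = rins (\<lambda>j. L j (r - Suc k)) x j"
proof -
  let ?y = "r - Suc k"
  have y: "Suc ?y = r - k" "r - ?y = Suc k" using assms by auto
  have zero: "\<not> X 0 (Suc k)" using X_bounds by fastforce
  have "growth (\<lambda>j. L j ?y) k" using L_growth[of ?y] y growth_le[of _ "r - ?y" k] by simp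
  then show thesis
  proof (rule row_growth[where f = "\<lambda>j. L j (r - k)" and X = "\<lambda>j. X j (Suc k)"])
    show "L 0 (r - k) = {}" by (rule L_left) simp
    fix j
    assume j: "j < k"
    have X: "X (Suc j) (Suc k) \<longleftrightarrow> back_cross mus r (Suc j) (Suc ?y)"
      using X_below[of j ?y] j assms y by simp
    have j': "Suc (Suc (j + ?y)) \<le> r" using j assms by simp
    show "L (Suc j) (r - k) = fwd_rule (L j ?y) (L j (r - k)) (L (Suc j) ?y) (X (Suc j) (Suc k))"
      unfolding X using L_cell(1)[OF j'] y by simp
    show "L j (r - k) = L j ?y \<and> L (Suc j) ?y = L j ?y" if "X (Suc j) (Suc k)"
      using L_cell(2)[OF j'] that y unfolding X by simp
  next
    assume "\<And>j. 1 \<le> j \<Longrightarrow> j \<le> k \<Longrightarrow> \<not> X j (Suc k)" "\<And>j. j \<le> k \<Longrightarrow> L j (r - k) = L j ?y"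
    moreover have "\<not> X j (Suc k)" if "j \<le> Suc k" for j
      using calculation(1)[of j] zero X_irrefl[of "Suc k"] that
      by (cases "j = 0"; cases "j = Suc k") auto
    ultimately show thesis using that(1) by blast
  next
    fix x
    assume *: "fresh (\<lambda>j. L j ?y) k x" "\<And>j. 1 \<le> j \<Longrightarrow> j \<le> k \<Longrightarrow> X j (Suc k) \<longleftrightarrow> j = x"
      "\<And>j. j \<le> k \<Longrightarrow> L j (r - k) = rins (\<lambda>j. L j ?y) x j"
    have x: "1 \<le> x" "x \<le> k" using *(1) by (auto simp: fresh_def)
    have "X j (Suc k) \<longleftrightarrow> j = x" if "j \<le> Suc k" for j
      using *(2)[of j] zero X_irrefl[of "Suc k"] that x
      by (cases "j = 0"; cases "j = Suc k") auto
    then show thesis using that(2) *(1,3) by blast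
  qed
qed

text \<open>After \<open>k\<close> steps Sundaram's tableau is the label row at height
  \<open>r - k\<close>, cut off at the antidiagonal, and the pairs found are the crosses in the
  first \<open>k\<close> matrix rows and columns. The next step descends one strip and extends the
  row by one point. An expansion finds no cross there and appends a box; a contraction finds the
  cross whose insertion it undoes.\<close>

lemma sundaram_state:
  assumes "k \<le> r"
  shows "\<exists>iota A. sundaram mus k = (iota, A, tr (tab_of_seq (\<lambda>j. L j (r - k)) k))
    \<and> A = {j. \<exists>i\<le>k. j \<le> k \<and> X j i}
    \<and> (\<forall>j i. j \<le> k \<longrightarrow> i \<le> k \<longrightarrow> X j i \<longrightarrow> iota j = i)
    \<and> A \<inter> ran (tab_of_seq (\<lambda>j. L j (r - k)) k) = {}"
  using assms
proof (induction k)
  case 0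
  have "\<not> X j 0" for j using X_bounds by fastforce
  then show ?case by (simp add: sundaram_def)
next
  case (Suc k)
  let ?K = "Suc k" and ?y = "r - Suc k"
  let ?e = "\<lambda>j. L j ?y" and ?f = "\<lambda>j. L j (r - k)"
  have k: "k < r" using Suc.prems by simp
  obtain iota A where IH: "sundaram mus k = (iota, A, tr (tab_of_seq ?f k))"
    "A = {j. \<exists>i\<le>k. j \<le> k \<and> X j i}" "\<And>j i. j \<le> k \<Longrightarrow> i \<le> k \<Longrightarrow> X j i \<Longrightarrow> iota j = i"
    "A \<inter> ran (tab_of_seq ?f k) = {}"
    using Suc.IH k by auto
  have st: "sundaram mus ?K = sund_step mus (iota, A, tr (tab_of_seq ?f k)) ?K"
    using IH(1) by (simp add: sundaram_def)
  have geK: "growth ?e ?K" using L_growth[of ?y] k by simp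
  then have ge: "growth ?e k" by (rule growth_SucD)
  have fk: "?f k = conj (mus ! k)" using L_diag[of k "r - k"] k by simp
  have eK: "?e ?K = conj (mus ! ?K)" using L_diag[of ?K ?y] k by simp
  have ek: "?e k = conj (mus ! k \<inter> mus ! ?K)" using L_subdiag[of k ?y] k by simp
  show ?case
  proof (rule mus_step[OF k])
    fix b
    assume b: "b \<notin> mus ! k" "mus ! ?K = insert b (mus ! k)"
    obtain p q where pq: "b = (p, q)" by force
    \<comment> \<open>On an expansion the smaller of the two shapes is \<open>mus ! k\<close>, so
      the borders of the strip agree at abscissa \<open>k\<close>; by \<open>rins_step\<close> this
      excludes a cross before that point.\<close>
    have ef: "?e k = ?f k" using b fk ek by (simp add: Int_absorb2 subset_insertI)
    have none: "\<And>j. j \<le> ?K \<Longrightarrow> \<not> X j ?K" and fe: "\<And>j. j \<le> k \<Longrightarrow> ?f j = ?e j"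
    proof -
      have "(\<forall>j\<le>?K. \<not> X j ?K) \<and> (\<forall>j\<le>k. ?f j = ?e j)"
      proof (rule L_row[OF k])
        fix x
        assume x: "fresh ?e k x" "\<And>j. j \<le> k \<Longrightarrow> ?f j = rins ?e x j"
        then show ?thesis using rins_step[OF ge x(1), of k] ef by (simp add: fresh_def)
      qed blast
      then show "\<And>j. j \<le> ?K \<Longrightarrow> \<not> X j ?K" "\<And>j. j \<le> k \<Longrightarrow> ?f j = ?e j" by auto
    qed
    have tab: "tab_of_seq ?f k = tab_of_seq ?e k" using fe by (rule tab_of_seq_cong)
    have "?e ?K = insert (q, p) (?e k)" "(q, p) \<notin> ?e k" using eK ef fk b pq by auto
    then have tabK: "tab_of_seq ?e ?K = (tab_of_seq ?f k)((q, p) \<mapsto> ?K)"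
      unfolding tab by (rule tab_of_seq_add)
    have "the_elem (mus ! ?K - mus ! k) = b" using b by (simp add: insert_Diff_if)
    then have "sundaram mus ?K = (iota, A, (tr (tab_of_seq ?f k))(b \<mapsto> ?K))"
      unfolding st using b(2) by (auto simp: sund_step_def simp del: fun_upd_apply)
    then have S: "sundaram mus ?K = (iota, A, tr (tab_of_seq ?e ?K))"
      unfolding tabK tr_upd pq .
    have cross: "X j i \<Longrightarrow> j \<le> ?K \<Longrightarrow> i \<le> ?K \<Longrightarrow> j \<le> k \<and> i \<le> k" for j i
      using none[of j] none[of i] X_sym[of j i] by (auto simp: le_Suc_eq)
    have A: "A = {j. \<exists>i\<le>?K. j \<le> ?K \<and> X j i}"
      unfolding IH(2) using cross le_SucI by blast
    have "ran (tab_of_seq ?e ?K) \<subseteq> insert ?K (ran (tab_of_seq ?f k))"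
      unfolding tabK by (auto simp: ran_def split: if_splits)
    moreover have "?K \<notin> A" unfolding IH(2) by simp
    ultimately have dis: "A \<inter> ran (tab_of_seq ?e ?K) = {}" using IH(4) by blast
    show ?thesis using S A dis IH(3) cross by blast
  next
    fix b
    assume b: "b \<notin> mus ! ?K" "mus ! k = insert b (mus ! ?K)"
    obtain p q where pq: "b = (p, q)" by force
    have eKk: "?e ?K = ?e k" using b ek eK by (simp add: Int_absorb1 subset_insertI)
    have fk': "?f k = insert (q, p) (?e k)" "(q, p) \<notin> ?e k" using fk ek b pq by auto
    obtain x where x: "fresh ?e k x" "\<And>j. j \<le> ?K \<Longrightarrow> X j ?K \<longleftrightarrow> j = x"
      "\<And>j. j \<le> k \<Longrightarrow> ?f j = rins ?e x j"
    proof (rule L_row[OF k])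
      assume "\<And>j. j \<le> k \<Longrightarrow> ?f j = ?e j"
      then have "?f k = ?e k" by simp
      then show thesis using fk' by blast
    qed (rule that)
    have xk: "1 \<le> x" "x \<le> k" using x(1) by (auto simp: fresh_def)
    have tab: "tab_of_seq ?f k = tab_of_seq (rins ?e x) k" using x(3) by (rule tab_of_seq_cong)
    have tabK: "tab_of_seq ?e ?K = tab_of_seq ?e k" using eKk by simp
    have "the_elem (mus ! k - mus ! ?K) = b" using b by (simp add: insert_Diff_if)
    moreover have "col_delete (tr (tab_of_seq ?f k)) (p, q) = (x, tr (tab_of_seq ?e k))"
      unfolding tab by (rule col_delete_tab_of_seq_rins[OF ge x(1)]) (use fk' x(3)[of k] in auto)
    moreover have "\<not> mus ! k \<subseteq> mus ! ?K" using b by auto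
    ultimately have S: "sundaram mus ?K = (iota(x := ?K, ?K := x), A \<union> {x, ?K}, tr (tab_of_seq ?e ?K))"
      unfolding st tabK pq by (simp add: sund_step_def)
    have ran: "ran (tab_of_seq ?f k) = insert x (ran (tab_of_seq ?e k))"
      unfolding tab by (rule ran_row_insert[OF ge x(1)])
    \<comment> \<open>Until this step \<open>x\<close> was an entry of the tableau, so the update of
      \<open>iota\<close> overwrites no earlier pair.\<close>
    have xA: "x \<notin> A" using IH(4) ran by blast
    have cross: "X j i \<Longrightarrow> j \<le> ?K \<Longrightarrow> i \<le> ?K
      \<Longrightarrow> (j \<le> k \<and> i \<le> k) \<or> (j = x \<and> i = ?K) \<or> (j = ?K \<and> i = x)" for j i
      using x(2)[of j] x(2)[of i] X_sym[of j i] by (auto simp: le_Suc_eq)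
    have Xx: "X x ?K" "X ?K x" using x(2)[of x] xk X_sym by auto
    have A: "A \<union> {x, ?K} = {j. \<exists>i\<le>?K. j \<le> ?K \<and> X j i}"
    proof (intro equalityI subsetI)
      fix j
      assume "j \<in> A \<union> {x, ?K}"
      then show "j \<in> {j. \<exists>i\<le>?K. j \<le> ?K \<and> X j i}"
        unfolding IH(2) using Xx xk by (auto intro: le_SucI)
    next
      fix j
      assume "j \<in> {j. \<exists>i\<le>?K. j \<le> ?K \<and> X j i}"
      then show "j \<in> A \<union> {x, ?K}" unfolding IH(2) using cross by blast
    qed
    have "x \<notin> ran (tab_of_seq ?e k)" using x(1) fresh_iff[OF ge] by blast
    moreover have "?K \<notin> ran (tab_of_seq ?e k)" using ran_tab_of_seq[OF ge] by auto
    ultimately have dis: "(A \<union> {x, ?K}) \<inter> ran (tab_of_seq ?e ?K) = {}"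
      unfolding tabK using IH(4) ran by blast
    have "(iota(x := ?K, ?K := x)) j = i" if "X j i" "j \<le> ?K" "i \<le> ?K" for j i
      using cross[OF that]
    proof (elim disjE conjE)
      assume ji: "j \<le> k" "i \<le> k"
      then have "j \<in> A" unfolding IH(2) using that(1) by blast
      then show ?thesis using xA ji IH(3)[OF ji that(1)] by auto
    qed (use xk in auto)
    then show ?thesis using S A dis by blast
  qed
qed

text \<open>Stated for any labelling \<open>G\<close> obeying the forward rules, since the diagrams
  for \<open>Q_Rob\<close> and \<open>I_Rob\<close> share their crosses and differ only in the
  bottom row. The strip above height \<open>y\<close> is matrix row \<open>r - y\<close>; by
  symmetry of the crosses its cross, if any, is in column \<open>iota (r - y)\<close>. Going up runs
  through the indices downwards, which accounts for \<open>rev\<close>.\<close>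

lemma grid_insertion:
  assumes G0: "growth (\<lambda>x. G x 0) r" and left: "\<And>y. y \<le> r \<Longrightarrow> G 0 y = {}"
    and cell: "\<And>x y. x < r \<Longrightarrow> y < r
      \<Longrightarrow> G (Suc x) (Suc y) = fwd_rule (G x y) (G x (Suc y)) (G (Suc x) y) (X (Suc x) (r - y))"
    and A: "A = {j. \<exists>i. X j i}" and iota: "\<And>j i. X j i \<Longrightarrow> iota j = i"
    and disj: "A \<inter> ran (tab_of_seq (\<lambda>x. G x 0) r) = {}"
  shows "growth (\<lambda>x. G x r) r" "tr (tab_of_seq (\<lambda>x. G x r) r)
    = foldl col_insert (tr (tab_of_seq (\<lambda>x. G x 0) r)) (rev (map iota (sorted_list_of_set A)))"
proof -
  let ?T = "\<lambda>y. tab_of_seq (\<lambda>x. G x y) r"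
  have XA: "X x i \<longleftrightarrow> i \<in> A \<and> x = iota i" for x i
    using iota X_sym unfolding A by blast
  have iA: "iota i \<in> A" "iota (iota i) = i" if "i \<in> A" for i
    using that iota X_sym XA unfolding A by blast+
  \<comment> \<open>The bound on the entries keeps the next letter fresh: \<open>iota\<close> maps
    \<open>A\<close> injectively into itself, and \<open>A\<close> is disjoint from the entries of
    the bottom row.\<close>
  have "y \<le> r \<Longrightarrow> growth (\<lambda>x. G x y) r
    \<and> tr (?T y) = foldl col_insert (tr (?T 0)) (map iota (filter (\<lambda>i. i \<in> A) (rev [Suc (r - y)..<Suc r])))
    \<and> ran (?T y) \<subseteq> ran (?T 0) \<union> iota ` {i \<in> A. r - y < i}" for y
  proof (induction y)
    case 0
    then show ?case using G0 by simp
  next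
    case (Suc y)
    let ?i = "r - y"
    have y: "y < r" using Suc.prems by simp
    have IH: "growth (\<lambda>x. G x y) r"
      "tr (?T y) = foldl col_insert (tr (?T 0)) (map iota (filter (\<lambda>i. i \<in> A) (rev [Suc ?i..<Suc r])))"
      "ran (?T y) \<subseteq> ran (?T 0) \<union> iota ` {i \<in> A. ?i < i}"
      using Suc by auto
    have i: "Suc (r - Suc y) = ?i" using y by simp
    have upt: "[?i..<Suc r] = ?i # [Suc ?i..<Suc r]" using y by (simp add: upt_conv_Cons del: upt_Suc)
    show ?case
    proof (cases "?i \<in> A")
      case False
      have "k \<le> r \<Longrightarrow> G k (Suc y) = G k y" for k
      proof (induction k)
        case 0
        then show ?case using left y by simp
      next
        case (Suc k)
        then show ?case using cell[of k y] y False XA fwd_rule_stay[OF growth_step[OF IH(1), of k]] by simp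
      qed
      then have "?T (Suc y) = ?T y" "growth (\<lambda>x. G x (Suc y)) r"
        using IH(1) by (auto intro: tab_of_seq_cong simp: growth_def)
      then show ?thesis unfolding i upt using IH False by force
    next
      case True
      let ?x = "iota ?i"
      have fr: "fresh (\<lambda>x. G x y) r ?x"
        unfolding fresh_iff[OF IH(1)]
      proof (intro conjI)
        show "1 \<le> ?x" "?x \<le> r" using X_bounds XA True by blast+
        show "?x \<notin> ran (?T y)"
        proof
          assume "?x \<in> ran (?T y)"
          then have "?x \<in> iota ` {i \<in> A. ?i < i}" using IH(3) disj iA(1)[OF True] by blast
          then obtain i' where i': "i' \<in> A" "?i < i'" "?x = iota i'" by blast
          have "?i = i'" using iA(2)[OF True] iA(2)[OF i'(1)] arg_cong[OF i'(3), of iota] by (metis (full_types))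
          then show False using i'(2) by (metis less_irrefl)
        qed
      qed
      have row: "k \<le> r \<Longrightarrow> G k (Suc y) = rins (\<lambda>x. G x y) ?x k" for k
      proof (induction k)
        case 0
        then show ?case using left y by simp
      next
        case (Suc k)
        have "X (Suc k) ?i \<longleftrightarrow> Suc k = ?x" using XA True by simp
        then show ?case using cell[of k y] y Suc by simp
      qed
      have T: "?T (Suc y) = tab_of_seq (rins (\<lambda>x. G x y) ?x) r"
        using row by (intro tab_of_seq_cong) simp
      have "growth (\<lambda>x. G x (Suc y)) r"
        using growth_rins[OF IH(1) fr] row by (simp add: growth_def)
      moreover have "tr (?T (Suc y)) = col_insert (tr (?T y)) ?x"
        unfolding T col_insert_tr tab_of_seq_row_insert[OF IH(1) fr] ..
      moreover have "ran (?T (Suc y)) = insert ?x (ran (?T y))"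
        unfolding T by (rule ran_row_insert[OF IH(1) fr])
      moreover have "r - Suc y < ?i" using y by simp
      ultimately show ?thesis unfolding i upt using IH(2,3) True by fastforce
    qed
  qed
  note this[of r]
  moreover have "filter (\<lambda>i. i \<in> A) [1..<Suc r] = sorted_list_of_set A"
  proof -
    have "A \<subseteq> {1..r}" unfolding A by (rule X_columns)
    then have "set (filter (\<lambda>i. i \<in> A) [1..<Suc r]) = A" by (auto simp del: upt_Suc)
    moreover have "sorted (filter (\<lambda>i. i \<in> A) [1..<Suc r])" "distinct (filter (\<lambda>i. i \<in> A) [1..<Suc r])"
      by (simp_all add: sorted_wrt_filter del: upt_Suc)
    ultimately show ?thesis using sorted_list_of_set.idem_if_sorted_distinct by metis
  qed
  ultimately show "growth (\<lambda>x. G x r) r" "tr (?T r)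
    = foldl col_insert (tr (?T 0)) (rev (map iota (sorted_list_of_set A)))"
    by (auto simp: rev_map simp flip: rev_filter)
qed

section \<open>The full square\<close>

lemma rob_lab_below: "x + y \<le> r \<Longrightarrow> rob_lab mus r x y = L x y"
  by (subst rob_lab.simps) simp

text \<open>Below the antidiagonal the labels come from the backward rules but satisfy the forward
  ones too, so the whole square can be read uniformly from the bottom.\<close>

lemma rob_lab_cell:
  assumes "x < r" "y < r"
  shows "rob_lab mus r (Suc x) (Suc y) = fwd_rule (rob_lab mus r x y) (rob_lab mus r x (Suc y))
    (rob_lab mus r (Suc x) y) (X (Suc x) (r - y))"
proof (cases "Suc x + Suc y \<le> r")
  case True
  then show ?thesis
    using L_cell(1)[of x y] X_below[of x y] assms by (simp add: rob_lab_below)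
next
  case False
  then show ?thesis by (subst rob_lab.simps) simp
qed

lemma rob_ilab_cell:
  "rob_ilab mus r (Suc x) (Suc y) = fwd_rule (rob_ilab mus r x y) (rob_ilab mus r x (Suc y))
    (rob_ilab mus r (Suc x) y) (X (Suc x) (r - y))"
  by (subst rob_ilab.simps) simp

lemma rob_ilab_border: "rob_ilab mus r 0 y = {}" "rob_ilab mus r x 0 = {}"
  by (subst rob_ilab.simps, simp)+

lemma roby_eq_sundaram:
  assumes S: "sundaram mus r = (iota, A, T)"
    and I: "I = rs_insertion iota A" and Q: "Q = foldl col_insert T (rev_reading_word I)"
  shows "A_Rob mus r = A" "\<And>j i. X j i \<Longrightarrow> iota j = i" "T_Rob mus r = T" "I_Rob mus r = I" "Q_Rob mus r = Q"
proof -
  have T: "T = tr (tab_of_seq (\<lambda>j. L j 0) r)" and A: "A = {j. \<exists>i. X j i}"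
    and iota: "\<And>j i. X j i \<Longrightarrow> iota j = i" and disj: "A \<inter> ran (tab_of_seq (\<lambda>j. L j 0) r) = {}"
    using sundaram_state[of r] S X_bounds by (simp_all) blast+
  show "A_Rob mus r = A" unfolding A A_Rob_def ..
  show "\<And>j i. X j i \<Longrightarrow> iota j = i" by fact
  have row0: "rob_lab mus r k 0 = L k 0" if "k \<le> r" for k using that rob_lab_below by simp
  have g0: "growth (\<lambda>k. rob_lab mus r k 0) r"
    using L_growth[of 0] row0 by (simp add: growth_def)
  have tab0: "tab_of_seq (\<lambda>k. rob_lab mus r k 0) r = tab_of_seq (\<lambda>j. L j 0) r"
    using row0 by (rule tab_of_seq_cong)
  show "T_Rob mus r = T"
    unfolding T_Rob_def T tab_of_seq_conj[OF g0] tab0 ..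
  let ?w = "map iota (sorted_list_of_set A)"
  have "\<And>y. y \<le> r \<Longrightarrow> rob_lab mus r 0 y = {}" using rob_lab_below L_left by simp
  note QR = grid_insertion[OF g0 this rob_lab_cell A iota, unfolded tab0, OF _ _ _ _ disj]
  have "Q_Rob mus r = foldl col_insert T (rev ?w)"
    unfolding Q_Rob_def T using tab_of_seq_conj QR by simp
  have gi: "growth (\<lambda>k. rob_ilab mus r k 0) r"
    by (simp add: growth_def rob_ilab_border grow_refl)
  have tabi: "tab_of_seq (\<lambda>k. rob_ilab mus r k 0) r = Map.empty"
    unfolding rob_ilab_border by (induction r) auto
  note IR = grid_insertion[OF gi rob_ilab_border(1) rob_ilab_cell A iota, unfolded tabi]
  have IRob: "I_Rob mus r = foldl col_insert Map.empty (rev ?w)"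
    unfolding I_Rob_def using tab_of_seq_conj IR by simp
  have Ar: "A \<subseteq> {1..r}" unfolding A by (rule X_columns)
  then have fin: "finite A" by (rule finite_subset) simp
  have inv: "iota i \<in> A \<and> iota (iota i) = i" if "i \<in> A" for i
    using that iota X_sym unfolding A by blast
  have "distinct ?w"
    using fin inv inj_on_inverseI[of A iota iota] by (simp add: distinct_map)
  moreover have "set ?w \<subseteq> A" using fin inv by auto
  moreover have pT: "ptab r T"
    unfolding T by (rule ptab_tr) (use L_growth[of 0] in \<open>auto simp: ptab_def\<close>)
  ultimately have w: "insertable r T ?w" "insertable r Map.empty ?w"
    using Ar disj ptab_empty unfolding insertable_def T ran_tr by auto
  have I': "I = foldl row_insert Map.empty ?w" unfolding I rs_insertion_def ..
  show "I_Rob mus r = I" unfolding IRob I' by (rule foldl_col_rev[OF w(2)])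
  show "Q_Rob mus r = Q"
    unfolding Q I' foldl_col_insert_reading_word[OF pT w(1)] by fact
qed

end

theorem theorem7p4:
  fixes mus :: "cell set list" and r :: nat
    and iota :: "nat \<Rightarrow> nat" and A :: "nat set" and T I Q :: tableau
  assumes "osc_tableau mus r"
    and "sundaram mus r = (iota, A, T)"
    and "I = rs_insertion iota A"
    and "Q = foldl col_insert T (rev_reading_word I)"
  shows "A_Rob mus r = A
       \<and> (\<forall>j i. rob_cross mus r j i \<longrightarrow> iota j = i)
       \<and> T_Rob mus r = T
       \<and> I_Rob mus r = I
       \<and> Q_Rob mus r = Q"
  using roby_eq_sundaram[OF assms] by blast

end
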